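(* Let $\mathcal{F}_{\beta,\nu}$ be the set of convolutional neural networks described in the context, and let $\mathcal{S}$ be a sample of size $n$ drawn i.i.d. from $\mathcal{D}$. Suppose the loss function $L$ is bounded by $B_0>0$ and is Lipschitz continuous with respect to a variant of the $\ell_2$-norm with constants $L_1,L_2$: for every $y\in\{1,\dots,C\}$ and all score vectors $\boldsymbol{s},\boldsymbol{s}'\in\mathbb{R}^C$, $$|L(\boldsymbol{s},y)-L(\boldsymbol{s}',y)|\le L_1\|\boldsymbol{s}-\boldsymbol{s}'\|_2+L_2|s_y-s'_y|.$$ Then for any $\delta\in(0,1)$, with probability at least $1-\delta$ over $\mathcal{S}$, $$\Phi(\mathcal{S},\delta)\ \precsim\ \mathcal{O}\left(\frac{W L_1\sqrt{C}\,\log(nC B_{\beta,\nu,\chi})}{\sqrt{n}}\right)+\mathcal{O}\left(\frac{W L_2\log(n B_{\beta,\nu,\chi})}{\sqrt{n}}\right),$$ where $B_{\beta,\nu,\chi}:=\chi\beta(1+\nu+\beta/L_a)^{L_a}$, $L_a=L_c+L_f$, and $W$ is the number of parameters of the networks in $\mathcal{F}_{\beta,\nu}$.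
   Context: Setting: $\mathcal{Y}=\{1,\dots,C\}$, $\mathcal{D}$ a distribution on $\mathcal{X}\times\mathcal{Y}$, $\mathcal{S}=\{(\boldsymbol{x}^{(i)},y^{(i)})\}_{i=1}^n$ i.i.d. from $\mathcal{D}$. The loss is $L(\boldsymbol{s},y)=\frac1K\sum_{k=1}^{K+1}\ell(s_y-s_{[k]})$ for a surrogate loss $\ell:\mathbb{R}\to\mathbb{R}_+$ and $1\le K\le C-1$, where $s_{[k]}$ is the $k$-th greatest entry of $\boldsymbol{s}\in\mathbb{R}^C$. Risks: $\mathcal{R}_K^\ell(f)=\mathbb{E}_{(\boldsymbol{x},y)\sim\mathcal{D}}[L(f(\boldsymbol{x}),y)]$ and $\hat{\mathcal{R}}_K^\ell(f,\mathcal{S})=\frac1n\sum_{i=1}^nL(f(\boldsymbol{x}^{(i)}),y^{(i)})$. For a function set $\mathcal{F}$ (here $\mathcal{F}=\mathcal{F}_{\beta,\nu}$), $$\Phi(\mathcal{S},\delta)=\sup_{f\in\mathcal{F}}\big(\mathcal{R}_K^\ell(f)-\hat{\mathcal{R}}_K^\ell(f,\mathcal{S})\big)-3B_0\sqrt{\frac{\log(2/\delta)}{2n}}.$$ Networks: fix an architecture with $L_c$ convolutional layers followed by $L_f$ fully-connected layers, with output in $\mathbb{R}^C$. Each convolutional layer is a zero-padded convolution with kernel $KN^{(l)}\in\mathbb{R}^{p_l\times p_l\times c_{l-1}\times c_l}$, $l=1,\dots,L_c$, followed by an activation function and an optional pooling operation; the fully-connected layers have parameter matrices $V^{(l)}$,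 $l=1,\dots,L_f$. All activation functions and pooling operations are $1$-Lipschitz. $\Theta=\{KN^{(1)},\dots,KN^{(L_c)},V^{(1)},\dots,V^{(L_f)}\}$ is the parameter set, with $W$ scalar parameters in total. Inputs $\boldsymbol{x}\in\mathbb{R}^{d\times d\times c}$ satisfy $\|\mathsf{vec}(\boldsymbol{x})\|\le\chi$, where $\mathsf{vec}$ is vectorization. $\mathsf{mt}(KN^{(l)})$ is the matrix of the linear operator given by convolution with $KN^{(l)}$, and $\|\cdot\|_2$ is the spectral norm. Fixed initial parameters $\Theta_0$ satisfy $\|\mathsf{mt}(KN_0^{(l)})\|_2\le1+\nu$ for $l\le L_c$ and $\|V_0^{(l)}\|_2\le1+\nu$ for $l\le L_f$. $\mathcal{F}_{\beta,\nu}$ is the set of such networks whose parameters satisfy $$\|\Theta-\Theta_0\|:=\sum_{l=1}^{L_c}\|\mathsf{mt}(KN^{(l)})-\mathsf{mt}(KN_0^{(l)})\|_2+\sum_{l=1}^{L_f}\|V^{(l)}-V_0^{(l)}\|_2\le\beta.$$ The scores of any two functions of the class differ by at most $1$ in each coordinate at each sample point (e.g. scores in $[0,1]$). $\precsim\mathcal{O}(\cdot)$ means: bounded above by the displayed quantity up to absolute multiplicative constants, for $n$ sufficiently large. *)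

theory Defs
  imports "HOL-Probability.Probability"
begin

section \<open>Vectors, tensors and matrices of variable size\<close>

text \<open>
  The sizes of the layers vary inside the statement and its constants have to be independent of them,
  so vectors, tensors and matrices are functions on index sets that are passed explicitly; values
  outside the index set are never read. The entries of a vector in \<open>\<real>\<^sup>m\<close> are indexed by \<open>{1..m}\<close>,
  those of a tensor in \<open>\<real>\<^bsup>d\<times>d\<times>c\<^esup>\<close> by \<open>grid d c\<close>. The Euclidean norm is \<^const>\<open>L2_set\<close>.
\<close>

type_synonym tensor = "nat \<times> nat \<times> nat \<Rightarrow> real"
type_synonym kernel = "nat \<times> nat \<times> nat \<times> nat \<Rightarrow> real"

definition grid :: "nat \<Rightarrow> nat \<Rightarrow> (nat \<times> nat \<times> nat) set" where
  "grid d c = {..<d} \<times> {..<d} \<times> {..<c}"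

definition tvec :: "nat \<Rightarrow> nat \<Rightarrow> tensor \<Rightarrow> nat \<Rightarrow> real" where
  "tvec d c x m = x ((m - 1) div (d * c), (m - 1) div c mod d, (m - 1) mod c)"

definition matvec :: "'j set \<Rightarrow> ('i \<Rightarrow> 'j \<Rightarrow> real) \<Rightarrow> ('j \<Rightarrow> real) \<Rightarrow> 'i \<Rightarrow> real" where
  "matvec J A x = (\<lambda>i. \<Sum>j\<in>J. A i j * x j)"

definition spectral_norm :: "'i set \<Rightarrow> 'j set \<Rightarrow> ('i \<Rightarrow> 'j \<Rightarrow> real) \<Rightarrow> real" where
  "spectral_norm I J A = (SUP x\<in>{x. L2_set x J \<le> 1}. L2_set (matvec J A x) I)"

definition one_Lipschitz ::
    "'j set \<Rightarrow> 'i set \<Rightarrow> (('j \<Rightarrow> real) \<Rightarrow> ('i \<Rightarrow> real)) \<Rightarrow> bool" where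
  "one_Lipschitz J I g \<longleftrightarrow>
     (\<forall>x x'. L2_set (\<lambda>i. g x i - g x' i) I \<le> L2_set (\<lambda>j. x j - x' j) J)"


section \<open>Convolution\<close>

definition zero_pad :: "nat \<Rightarrow> tensor \<Rightarrow> int \<Rightarrow> int \<Rightarrow> nat \<Rightarrow> real" where
  "zero_pad d x u v k =
     (if 0 \<le> u \<and> u < int d \<and> 0 \<le> v \<and> v < int d then x (nat u, nat v, k) else 0)"

text \<open>
  The padding preserves the spatial size, so the output is a \<open>d \<times> d\<close> image. As usual for neural
  networks the kernel is not reflected; it is centred at position \<open>(p - 1) div 2\<close>.
\<close>

definition conv :: "nat \<Rightarrow> nat \<Rightarrow> nat \<Rightarrow> kernel \<Rightarrow> tensor \<Rightarrow> tensor" where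
  "conv d p c K x = (\<lambda>(i, j, k').
     \<Sum>a<p. \<Sum>b<p. \<Sum>k<c.
       K (a, b, k, k') * zero_pad d x (int i + int a - int ((p - 1) div 2))
                                      (int j + int b - int ((p - 1) div 2)) k)"

definition mt :: "nat \<Rightarrow> nat \<Rightarrow> nat \<Rightarrow> kernel \<Rightarrow> nat \<times> nat \<times> nat \<Rightarrow> nat \<times> nat \<times> nat \<Rightarrow> real" where
  "mt d p c K r s = conv d p c K (\<lambda>t. if t = s then 1 else 0) r"


section \<open>Convolutional networks\<close>

text \<open>
  Layers are numbered from 1. The input of convolutional layer \<open>l\<close> lies in
  \<open>grid (side (l - 1)) (chan (l - 1))\<close>, and its output, after activation and pooling, in
  \<open>grid (side l) (chan l)\<close>; a layer without pooling has the identity as \<open>pool\<close>. Activations are maps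
  of the whole vector or tensor; this includes scalar functions applied to each entry.
\<close>

record cnn_arch =
  convs :: nat
  fulls :: nat
  side :: "nat \<Rightarrow> nat"
  chan :: "nat \<Rightarrow> nat"
  ksize :: "nat \<Rightarrow> nat"
  width :: "nat \<Rightarrow> nat"
  cact :: "nat \<Rightarrow> tensor \<Rightarrow> tensor"
  pool :: "nat \<Rightarrow> tensor \<Rightarrow> tensor"
  fcact :: "nat \<Rightarrow> (nat \<Rightarrow> real) \<Rightarrow> (nat \<Rightarrow> real)"

definition is_cnn_arch :: "cnn_arch \<Rightarrow> nat \<Rightarrow> nat \<Rightarrow> nat \<Rightarrow> bool" where
  "is_cnn_arch A d c C \<longleftrightarrow>
     side A 0 = d \<and> chan A 0 = c \<and>
     width A 0 = side A (convs A) * side A (convs A) * chan A (convs A) \<and>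
     width A (fulls A) = C \<and>
     (\<forall>l\<in>{1..convs A}.
        one_Lipschitz (grid (side A (l - 1)) (chan A l)) (grid (side A (l - 1)) (chan A l)) (cact A l) \<and>
        one_Lipschitz (grid (side A (l - 1)) (chan A l)) (grid (side A l) (chan A l)) (pool A l)) \<and>
     (\<forall>l\<in>{1..fulls A}. one_Lipschitz {1..width A l} {1..width A l} (fcact A l))"

primrec conv_layers :: "cnn_arch \<Rightarrow> (nat \<Rightarrow> kernel) \<Rightarrow> nat \<Rightarrow> tensor \<Rightarrow> tensor" where
  "conv_layers A KN 0 x = x"
| "conv_layers A KN (Suc l) x =
     pool A (Suc l) (cact A (Suc l)
       (conv (side A l) (ksize A (Suc l)) (chan A l) (KN (Suc l)) (conv_layers A KN l x)))"

primrec full_layers ::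
    "cnn_arch \<Rightarrow> (nat \<Rightarrow> nat \<Rightarrow> nat \<Rightarrow> real) \<Rightarrow> nat \<Rightarrow> (nat \<Rightarrow> real) \<Rightarrow> (nat \<Rightarrow> real)" where
  "full_layers A V 0 v = v"
| "full_layers A V (Suc l) v =
     fcact A (Suc l) (matvec {1..width A l} (V (Suc l)) (full_layers A V l v))"

definition cnn ::
    "cnn_arch \<Rightarrow> (nat \<Rightarrow> kernel) \<Rightarrow> (nat \<Rightarrow> nat \<Rightarrow> nat \<Rightarrow> real) \<Rightarrow> tensor \<Rightarrow> (nat \<Rightarrow> real)" where
  "cnn A KN V x =
     full_layers A V (fulls A)
       (tvec (side A (convs A)) (chan A (convs A)) (conv_layers A KN (convs A) x))"

definition num_params :: "cnn_arch \<Rightarrow> nat" where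
  "num_params A =
     (\<Sum>l=1..convs A. ksize A l * ksize A l * chan A (l - 1) * chan A l) +
     (\<Sum>l=1..fulls A. width A l * width A (l - 1))"

definition conv_mat :: "cnn_arch \<Rightarrow> nat \<Rightarrow> kernel \<Rightarrow> nat \<times> nat \<times> nat \<Rightarrow> nat \<times> nat \<times> nat \<Rightarrow> real" where
  "conv_mat A l = mt (side A (l - 1)) (ksize A l) (chan A (l - 1))"

definition conv_norm :: "cnn_arch \<Rightarrow> nat \<Rightarrow> (nat \<times> nat \<times> nat \<Rightarrow> nat \<times> nat \<times> nat \<Rightarrow> real) \<Rightarrow> real" where
  "conv_norm A l =
     spectral_norm (grid (side A (l - 1)) (chan A l)) (grid (side A (l - 1)) (chan A (l - 1)))"

definition full_norm :: "cnn_arch \<Rightarrow> nat \<Rightarrow> (nat \<Rightarrow> nat \<Rightarrow> real) \<Rightarrow> real" where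
  "full_norm A l = spectral_norm {1..width A l} {1..width A (l - 1)}"

definition param_dist ::
    "cnn_arch \<Rightarrow> (nat \<Rightarrow> kernel) \<Rightarrow> (nat \<Rightarrow> nat \<Rightarrow> nat \<Rightarrow> real) \<Rightarrow>
     (nat \<Rightarrow> kernel) \<Rightarrow> (nat \<Rightarrow> nat \<Rightarrow> nat \<Rightarrow> real) \<Rightarrow> real" where
  "param_dist A KN V KN' V' =
     (\<Sum>l=1..convs A. conv_norm A l (\<lambda>r s. conv_mat A l (KN l) r s - conv_mat A l (KN' l) r s)) +
     (\<Sum>l=1..fulls A. full_norm A l (\<lambda>i j. V l i j - V' l i j))"

definition init_bounded ::
    "cnn_arch \<Rightarrow> (nat \<Rightarrow> kernel) \<Rightarrow> (nat \<Rightarrow> nat \<Rightarrow> nat \<Rightarrow> real) \<Rightarrow> real \<Rightarrow> bool" where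
  "init_bounded A KN0 V0 \<nu> \<longleftrightarrow>
     (\<forall>l\<in>{1..convs A}. conv_norm A l (conv_mat A l (KN0 l)) \<le> 1 + \<nu>) \<and>
     (\<forall>l\<in>{1..fulls A}. full_norm A l (V0 l) \<le> 1 + \<nu>)"

definition cnn_class ::
    "cnn_arch \<Rightarrow> (nat \<Rightarrow> kernel) \<Rightarrow> (nat \<Rightarrow> nat \<Rightarrow> nat \<Rightarrow> real) \<Rightarrow> real \<Rightarrow> (tensor \<Rightarrow> nat \<Rightarrow> real) set" where
  "cnn_class A KN0 V0 \<beta> = {cnn A KN V | KN V. param_dist A KN V KN0 V0 \<le> \<beta>}"

definition B_const :: "cnn_arch \<Rightarrow> real \<Rightarrow> real \<Rightarrow> real \<Rightarrow> real" where
  "B_const A \<beta> \<nu> chi =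
     chi * \<beta> * (1 + \<nu> + \<beta> / real (convs A + fulls A)) ^ (convs A + fulls A)"


section \<open>Loss and risks\<close>

definition kth_greatest :: "nat \<Rightarrow> (nat \<Rightarrow> real) \<Rightarrow> nat \<Rightarrow> real" where
  "kth_greatest C s k = rev (sort (map s [1..<Suc C])) ! (k - 1)"

definition topk_loss :: "(real \<Rightarrow> real) \<Rightarrow> nat \<Rightarrow> nat \<Rightarrow> (nat \<Rightarrow> real) \<Rightarrow> nat \<Rightarrow> real" where
  "topk_loss ell K C s y = (1 / real K) * (\<Sum>k=1..K+1. ell (s y - kth_greatest C s k))"

definition sample_space :: "nat \<Rightarrow> nat \<Rightarrow> nat \<Rightarrow> (tensor \<times> nat) measure" where
  "sample_space d c C = (\<Pi>\<^sub>M i\<in>grid d c. (borel :: real measure)) \<Otimes>\<^sub>M count_space {1..C}"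

definition risk ::
    "(tensor \<times> nat) measure \<Rightarrow> ((nat \<Rightarrow> real) \<Rightarrow> nat \<Rightarrow> real) \<Rightarrow> (tensor \<Rightarrow> nat \<Rightarrow> real) \<Rightarrow> real" where
  "risk D L f = (\<integral>(x, y). L (f x) y \<partial>D)"

definition emp_risk ::
    "nat \<Rightarrow> (nat \<Rightarrow> tensor \<times> nat) \<Rightarrow> ((nat \<Rightarrow> real) \<Rightarrow> nat \<Rightarrow> real) \<Rightarrow> (tensor \<Rightarrow> nat \<Rightarrow> real) \<Rightarrow> real" where
  "emp_risk n S L f = (1 / real n) * (\<Sum>i=1..n. case S i of (x, y) \<Rightarrow> L (f x) y)"

definition Phi ::
    "(tensor \<times> nat) measure \<Rightarrow> ((nat \<Rightarrow> real) \<Rightarrow> nat \<Rightarrow> real) \<Rightarrow> (tensor \<Rightarrow> nat \<Rightarrow> real) set \<Rightarrow> real \<Rightarrow>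
     nat \<Rightarrow> (nat \<Rightarrow> tensor \<times> nat) \<Rightarrow> real \<Rightarrow> real" where
  "Phi D L F B0 n S \<delta> =
     (SUP f\<in>F. risk D L f - emp_risk n S L f) - 3 * B0 * sqrt (ln (2 / \<delta>) / (2 * real n))"

end

theory Submission
  imports Defs
begin

text \<open>
  Every score of the network depends on the entries of the layer matrices in a Lipschitz way, with a
  constant that depends only on the architecture, \<open>\<beta>\<close>, the initial parameters and \<open>chi\<close>. Rounding the
  \<open>W\<close> parameters to multiples of \<open>1 / n\<close> therefore gives a net of \<open>(2 \<lceil>\<beta>\<rceil> n + 1) ^ W\<close> functions with
  error \<open>O(W / n)\<close>, and the logarithm of its size is at most \<open>2 W ln n\<close> for large \<open>n\<close>. Fix one member
  \<open>f\<^sub>0\<close> of the class. Hoeffding's inequality for the loss of \<open>f\<^sub>0\<close> costs \<open>B0\<close> times the confidence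
  term. For the differences to the loss of \<open>f\<^sub>0\<close>, which are bounded both by \<open>B0\<close> and by
  \<open>\<Delta> = L1 sqrt C + L2\<close> because scores differ by at most 1, Hoeffding's inequality and a union bound
  over the net cost \<open>2 B0\<close> times the confidence term plus \<open>O(\<Delta> W ln n / sqrt n)\<close>. Since \<open>n\<close> may be large
  in terms of \<open>B_const\<close>, one has \<open>ln n \<le> 2 ln (n B_const)\<close>.
\<close>

section \<open>Uniform deviations over a net\<close>

text \<open>On the product space the tuple of coordinates is the identity, since its elements are
  extensional; its law is thus the product of the marginals, which characterizes
  independence.\<close>

lemma indep_vars_PiM_component:
  assumes "I \<noteq> {}" "\<And>i. i \<in> I \<Longrightarrow> prob_space (M i)"
  shows "prob_space.indep_vars (PiM I M) M (\<lambda>i S. S i) I"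
proof -
  interpret prob_space "PiM I M" by (intro prob_space_PiM assms)
  have "distr (PiM I M) (PiM I M) (\<lambda>x. \<lambda>i\<in>I. x i) = distr (PiM I M) (PiM I M) (\<lambda>x. x)"
    by (intro distr_cong) (auto simp: space_PiM PiE_def extensional_restrict)
  also have "\<dots> = PiM I (\<lambda>i. distr (PiM I M) (M i) (\<lambda>S. S i))"
    by (simp add: distr_id cong: PiM_cong) (intro PiM_cong refl distr_PiM_component[symmetric] assms; simp)
  finally show ?thesis using assms(1) by (subst indep_vars_iff_distr_eq_PiM') auto
qed

text \<open>Hoeffding's inequality for a single function of the sample, solved for the deviation
  that has failure probability \<open>p\<close>.\<close>

lemma Hoeffding_PiM:
  fixes D :: "'a measure" and u :: "'a \<Rightarrow> real"
  assumes D: "prob_space D" and u[measurable]: "u \<in> borel_measurable D"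
    and ab: "AE z in D. a \<le> u z \<and> u z \<le> b" and n: "n \<ge> 1" and p: "0 < p" "p \<le> 1"
  shows "measure (\<Pi>\<^sub>M i\<in>{1..n}. D) {S \<in> space (\<Pi>\<^sub>M i\<in>{1..n}. D).
            (\<integral>z. u z \<partial>D) - (1 / real n) * (\<Sum>i=1..n. u (S i)) > (b - a) * sqrt (ln (1 / p) / (2 * real n))} \<le> p"
proof -
  let ?P = "\<Pi>\<^sub>M i\<in>{1..n}. D"
  let ?\<mu> = "\<integral>z. u z \<partial>D"
  interpret D: prob_space D by fact
  interpret P: prob_space ?P by (intro prob_space_PiM D)
  have meas[measurable]: "(\<lambda>S. u (S i)) \<in> borel_measurable ?P" if "i \<in> {1..n}" for i
    using that by measurable
  have distr: "distr ?P borel (\<lambda>S. u (S i)) = distr D borel u" if "i \<in> {1..n}" for i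
  proof -
    have "distr ?P borel (\<lambda>S. u (S i)) = distr (distr ?P D (\<lambda>S. S i)) borel u"
      using that by (subst distr_distr) (auto simp: o_def)
    also have "distr ?P D (\<lambda>S. S i) = D"
      using distr_PiM_component[of "{1..n}" "\<lambda>_. D" i] D that by simp
    finally show ?thesis .
  qed
  have ABS: "\<forall>i\<in>{1..n}. AE S in ?P. a \<le> u (S i) \<and> u (S i) \<le> b"
    using AE_PiM_component[of "{1..n}" "\<lambda>_. D" _ "\<lambda>z. a \<le> u z \<and> u z \<le> b"] D ab by auto
  show ?thesis
  proof (cases "a < b")
    case True
    have 1: "1 \<in> {1..n}" using n by simp
    have rv[measurable]: "P.random_variable borel (\<lambda>S. u (S 1))" using meas[OF 1] .
    have E: "P.expectation (\<lambda>S. u (S 1)) = ?\<mu>"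
      using integral_distr[of "\<lambda>S. S 1" ?P D u] distr_PiM_component[of "{1..n}" "\<lambda>_. D" 1] D 1
      by simp
    interpret H: Hoeffding_ineq_iid ?P "{1..n}" "\<lambda>i S. u (S i)" "\<lambda>S. u (S 1)" a b ?\<mu>
    proof unfold_locales
      show "P.indep_vars (\<lambda>_. borel) (\<lambda>i S. u (S i)) {1..n}"
        by (rule P.indep_vars_compose2[OF indep_vars_PiM_component]) (use D n in auto)
      show "?\<mu> \<equiv> P.expectation (\<lambda>S. u (S 1))" using E by simp
    next
      fix i assume "i \<in> {1..n}"
      thus "distr ?P borel (\<lambda>S. u (S i)) = distr ?P borel (\<lambda>S. u (S 1))"
        by (simp only: distr[OF 1] distr)
    qed (use ABS 1 in auto)
    define e where "e = (b - a) * sqrt (ln (1 / p) / (2 * real n))"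
    have "0 \<le> ln (1 / p)" using p by simp
    hence e: "e \<ge> 0" using True unfolding e_def by simp
    have "e\<^sup>2 = (b - a)\<^sup>2 * (ln (1 / p) / (2 * real n))"
      unfolding e_def power_mult_distrib using \<open>0 \<le> ln (1 / p)\<close> by simp
    \<comment> \<open>The deviation \<open>e\<close> is chosen such that Hoeffding's exponent is
      exactly \<open>ln p\<close>.\<close>
    hence ex: "-2 * real n * e\<^sup>2 / (b - a)\<^sup>2 = ln p"
      using True n p by (simp add: ln_div)
    have "measure ?P {S \<in> space ?P. ?\<mu> - (1 / real n) * (\<Sum>i=1..n. u (S i)) > e}
        \<le> measure ?P {S \<in> space ?P. (\<Sum>i=1..n. u (S i)) / real n \<le> ?\<mu> - e}"
      by (intro P.finite_measure_mono) auto
    also have "\<dots> \<le> exp (-2 * real n * e\<^sup>2 / (b - a)\<^sup>2)"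
      using H.Hoeffding_ineq_le'[OF e True] n by simp
    also have "\<dots> = p" unfolding ex using p by simp
    finally show ?thesis unfolding e_def .
  next
    case False
    \<comment> \<open>In the degenerate case \<open>u\<close> is almost everywhere constant, so the
      deviation is almost surely 0 and the strict inequality fails.\<close>
    have "AE z in D. b \<ge> a" using ab by (rule AE_mp) auto
    hence "a = b" using False by simp
    have "?\<mu> = (\<integral>z. a \<partial>D)" by (rule integral_cong_AE) (use ab \<open>a = b\<close> in auto)
    hence mu: "?\<mu> = a" by (simp add: D.prob_space)
    have "AE S in ?P. \<forall>i\<in>{1..n}. u (S i) = a"
    proof (rule AE_finite_allI)
      fix i assume "i \<in> {1..n}"
      hence "AE S in ?P. a \<le> u (S i) \<and> u (S i) \<le> b" using ABS by blast
      thus "AE S in ?P. u (S i) = a" by eventually_elim (use \<open>a = b\<close> in auto)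
    qed simp
    hence "AE S in ?P. S \<notin> {S \<in> space ?P. ?\<mu> - (1 / real n) * (\<Sum>i=1..n. u (S i)) > (b - a) * sqrt (ln (1 / p) / (2 * real n))}"
      by eventually_elim (use n mu \<open>a = b\<close> in simp)
    hence "measure ?P {S \<in> space ?P. ?\<mu> - (1 / real n) * (\<Sum>i=1..n. u (S i)) > (b - a) * sqrt (ln (1 / p) / (2 * real n))} = 0"
      by (subst P.prob_eq_0) auto
    thus ?thesis using p by simp
  qed
qed

lemma sqrt_add_le: "0 \<le> x \<Longrightarrow> 0 \<le> y \<Longrightarrow> sqrt (x + y) \<le> sqrt x + sqrt y"
  by (rule real_le_lsqrt) (auto simp: power2_sum)

text \<open>The expectation and the empirical mean each change by at most \<epsilon>. The sample
  points are treated separately because a fixed sample may contain points of a null set.\<close>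

lemma deviation_le:
  fixes g h :: "'a \<Rightarrow> real"
  assumes D: "prob_space D" and int: "integrable D g" "integrable D h" and n: "n \<ge> 1"
    and AE: "AE z in D. \<bar>h z - g z\<bar> \<le> \<epsilon>" and S: "\<And>i. i \<in> {1..n} \<Longrightarrow> \<bar>h (S i) - g (S i)\<bar> \<le> \<epsilon>"
  shows "(\<integral>z. h z \<partial>D) - (1 / real n) * (\<Sum>i=1..n. h (S i))
       \<le> (\<integral>z. g z \<partial>D) - (1 / real n) * (\<Sum>i=1..n. g (S i)) + 2 * \<epsilon>"
proof -
  interpret D: prob_space D by fact
  have "(\<integral>z. h z \<partial>D) \<le> (\<integral>z. g z + \<epsilon> \<partial>D)"
  proof (rule integral_mono_AE)
    show "AE z in D. h z \<le> g z + \<epsilon>" using AE by eventually_elim linarith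
  qed (use int in auto)
  also have "\<dots> = (\<integral>z. g z \<partial>D) + \<epsilon>" using int by (simp add: D.prob_space)
  finally have 1: "(\<integral>z. h z \<partial>D) \<le> (\<integral>z. g z \<partial>D) + \<epsilon>" .
  have "(\<Sum>i=1..n. g (S i)) \<le> (\<Sum>i=1..n. h (S i) + \<epsilon>)"
  proof (rule sum_mono)
    fix i assume "i \<in> {1..n}"
    from S[OF this] show "g (S i) \<le> h (S i) + \<epsilon>" by linarith
  qed
  also have "\<dots> = (\<Sum>i=1..n. h (S i)) + real n * \<epsilon>" by (simp add: sum.distrib)
  finally have "(1 / real n) * (\<Sum>i=1..n. g (S i)) \<le> (1 / real n) * ((\<Sum>i=1..n. h (S i)) + real n * \<epsilon>)"
    by (intro mult_left_mono) auto
  hence "(1 / real n) * (\<Sum>i=1..n. g (S i)) \<le> (1 / real n) * (\<Sum>i=1..n. h (S i)) + \<epsilon>"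
    using n by (simp add: field_simps)
  with 1 show ?thesis by linarith
qed

text \<open>Each \<open>h\<close> is split as \<open>h0 + (g - h0) + (h - g)\<close> with
  \<open>g\<close> in the net. Hoeffding's inequality is applied to the first two parts, and the
  third costs \<open>2 * \<epsilon>\<close>. Centring at \<open>h0\<close> lets the diameter
  \<Delta>, instead of \<open>B\<close>, multiply the term with the net size.\<close>

lemma uniform_deviation:
  fixes D :: "'a measure" and H :: "('a \<Rightarrow> real) set"
  assumes D: "prob_space D"
    and H[measurable]: "\<And>h. h \<in> H \<Longrightarrow> h \<in> borel_measurable D"
    and B: "\<And>h z. h \<in> H \<Longrightarrow> z \<in> space D \<Longrightarrow> 0 \<le> h z \<and> h z \<le> B"
    and Delta: "0 \<le> \<Delta>" "AE z in D. \<forall>g\<in>H. \<forall>h\<in>H. \<bar>g z - h z\<bar> \<le> \<Delta>"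
    and N: "N \<subseteq> H" "finite N" "N \<noteq> {}"
    and net: "\<And>h. h \<in> H \<Longrightarrow> \<exists>g\<in>N. \<forall>z\<in>G. \<bar>h z - g z\<bar> \<le> \<epsilon>"
    and G: "AE z in D. z \<in> G"
    and n: "n \<ge> 1" and \<delta>: "0 < \<delta>" "\<delta> < 1"
  obtains E where "E \<in> sets (\<Pi>\<^sub>M i\<in>{1..n}. D)" "measure (\<Pi>\<^sub>M i\<in>{1..n}. D) E \<le> \<delta>"
    "\<And>S h. S \<in> space (\<Pi>\<^sub>M i\<in>{1..n}. D) - E \<Longrightarrow> h \<in> H \<Longrightarrow>
       (\<integral>z. h z \<partial>D) - (1 / real n) * (\<Sum>i=1..n. h (S i))
         \<le> 3 * B * sqrt (ln (2 / \<delta>) / (2 * real n))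
            + 2 * \<Delta> * sqrt (ln (real (card N)) / (2 * real n)) + 2 * \<epsilon>"
proof -
  let ?P = "\<Pi>\<^sub>M i\<in>{1..n}. D"
  interpret D: prob_space D by fact
  interpret P: prob_space ?P by (intro prob_space_PiM D)
  define dev where "dev u S = (\<integral>z. u z \<partial>D) - (1 / real n) * (\<Sum>i=1..n. u (S i))" for u :: "'a \<Rightarrow> real" and S
  have dev_meas[measurable]: "dev u \<in> borel_measurable ?P" if [measurable]: "u \<in> borel_measurable D" for u
    unfolding dev_def by measurable
  obtain h0 where h0: "h0 \<in> N" using N by auto
  note h0' = subsetD[OF N(1) h0]
  obtain z0 where z0: "z0 \<in> space D" using D.not_empty by auto
  have B0: "0 \<le> B" using B[OF h0' z0] by linarith
  \<comment> \<open>The bound \<open>\<Delta>\<close> is used in the term with the net size, \<open>B\<close> in the term with the confidence.\<close>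
  define b where "b = min \<Delta> B"
  have b: "0 \<le> b" "b \<le> \<Delta>" "b \<le> B" using B0 Delta by (auto simp: b_def)
  have M: "0 < real (card N)" using N by (simp add: card_gt_0_iff)
  \<comment> \<open>Half of \<delta> goes to \<open>h0\<close>; the other half is shared equally by
    the members of the net.\<close>
  define p where "p = \<delta> / (2 * real (card N))"
  have M1: "1 \<le> real (card N)" using N by (simp add: Suc_leI card_gt_0_iff)
  have p: "0 < p" "p \<le> 1" using \<delta> M1 by (auto simp: p_def divide_simps)
  define E0 where "E0 = {S \<in> space ?P. dev h0 S > (B - 0) * sqrt (ln (1 / (\<delta> / 2)) / (2 * real n))}"
  define E1 where "E1 g = {S \<in> space ?P. dev (\<lambda>z. g z - h0 z) S > (b - (-b)) * sqrt (ln (1 / p) / (2 * real n))}" for g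
  have E0s[measurable]: "E0 \<in> sets ?P" unfolding E0_def using H[OF h0'] by measurable
  have E1s[measurable]: "E1 g \<in> sets ?P" if "g \<in> N" for g
  proof -
    have [measurable]: "(\<lambda>z. g z - h0 z) \<in> borel_measurable D"
      using that N h0' by (intro borel_measurable_diff H) auto
    show ?thesis unfolding E1_def by measurable
  qed
  have P0: "measure ?P E0 \<le> \<delta> / 2"
    unfolding E0_def dev_def using B[OF h0'] \<delta>
    by (intro Hoeffding_PiM D H h0' n AE_I2) auto
  have P1: "measure ?P (E1 g) \<le> p" if "g \<in> N" for g
    unfolding E1_def dev_def
  proof (intro Hoeffding_PiM D n p)
    show "(\<lambda>z. g z - h0 z) \<in> borel_measurable D"
      using that N h0' by (intro borel_measurable_diff H) auto
    have g: "g \<in> H" using that N by auto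
    show "AE z in D. - b \<le> g z - h0 z \<and> g z - h0 z \<le> b"
      using Delta(2) AE_space
    proof eventually_elim
      case (elim z)
      hence "\<bar>g z - h0 z\<bar> \<le> \<Delta>" using g h0' by auto
      moreover have "\<bar>g z - h0 z\<bar> \<le> B" using B[OF g elim(2)] B[OF h0' elim(2)] by linarith
      ultimately show ?case unfolding b_def by linarith
    qed
  qed
  \<comment> \<open>Almost every sample lies in \<open>G\<close> entirely. The exceptional null set
    \<open>Z\<close> joins the bad event, so off \<open>E\<close> the net approximates at the sample
    points too.\<close>
  have "AE S in ?P. \<forall>i\<in>{1..n}. S i \<in> G"
    by (rule AE_finite_allI) (use AE_PiM_component[of "{1..n}" "\<lambda>_. D" _ "\<lambda>z. z \<in> G"] D G in auto)
  then obtain Z where Z: "Z \<in> null_sets ?P" "\<And>S. S \<in> space ?P - Z \<Longrightarrow> \<forall>i\<in>{1..n}. S i \<in> G"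
    by (auto elim!: AE_E3)
  define E where "E = E0 \<union> (\<Union>g\<in>N. E1 g) \<union> Z"
  show ?thesis
  proof
    show "E \<in> sets ?P" unfolding E_def using N(2) null_setsD2[OF Z(1)] E0s E1s
      by (intro sets.Un sets.finite_UN) auto
    have "measure ?P E \<le> measure ?P (E0 \<union> (\<Union>g\<in>N. E1 g)) + measure ?P Z"
      unfolding E_def using N(2) E0s E1s null_setsD2[OF Z(1)]
      by (intro measure_Un_le sets.Un sets.finite_UN) auto
    also have "measure ?P Z = 0" using Z(1) by (simp add: null_sets_def measure_def)
    also have "measure ?P (E0 \<union> (\<Union>g\<in>N. E1 g)) \<le> measure ?P E0 + measure ?P (\<Union>g\<in>N. E1 g)"
      using N(2) E0s E1s by (intro measure_Un_le sets.finite_UN) auto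
    also have "measure ?P (\<Union>g\<in>N. E1 g) \<le> (\<Sum>g\<in>N. measure ?P (E1 g))"
      using N(2) E1s by (intro measure_UNION_le) auto
    also have "\<dots> \<le> (\<Sum>g\<in>N. p)" by (intro sum_mono P1)
    also have "\<dots> = \<delta> / 2" using M by (simp add: p_def)
    finally show "measure ?P E \<le> \<delta>" using P0 by simp
  next
    fix S h assume S: "S \<in> space ?P - E" and h: "h \<in> H"
    obtain g where g: "g \<in> N" "\<And>z. z \<in> G \<Longrightarrow> \<bar>h z - g z\<bar> \<le> \<epsilon>" using net[OF h] by blast
    have gH: "g \<in> H" using g N by auto
    have int: "integrable D k" if "k \<in> H" for k
      by (rule D.integrable_const_bound[of _ B]) (use B[OF that] H[OF that] in auto)
    have SG: "S i \<in> G" if "i \<in> {1..n}" for i using Z(2)[of S] S that by (auto simp: E_def)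
    have 1: "dev h S \<le> dev g S + 2 * \<epsilon>"
      unfolding dev_def
    proof (rule deviation_le[OF D int[OF gH] int[OF h] n])
      show "AE z in D. \<bar>h z - g z\<bar> \<le> \<epsilon>" using G by eventually_elim (rule g(2))
      show "\<bar>h (S i) - g (S i)\<bar> \<le> \<epsilon>" if "i \<in> {1..n}" for i using g(2)[OF SG[OF that]] .
    qed
    have 2: "dev g S = dev (\<lambda>z. g z - h0 z) S + dev h0 S"
      unfolding dev_def using int[OF gH] int[OF h0'] by (simp add: sum_subtractf algebra_simps diff_divide_distrib)
    have 3: "dev h0 S \<le> B * sqrt (ln (2 / \<delta>) / (2 * real n))"
      using S by (auto simp: E_def E0_def)
    have 4: "dev (\<lambda>z. g z - h0 z) S \<le> 2 * b * sqrt (ln (1 / p) / (2 * real n))"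
      using S g(1) by (auto simp: E_def E1_def)
    have "ln (1 / p) = ln (2 / \<delta>) + ln (real (card N))"
      using \<delta> M by (simp add: p_def ln_div ln_mult)
    hence "sqrt (ln (1 / p) / (2 * real n)) = sqrt (ln (2 / \<delta>) / (2 * real n) + ln (real (card N)) / (2 * real n))"
      by (simp add: add_divide_distrib)
    also have "\<dots> \<le> sqrt (ln (2 / \<delta>) / (2 * real n)) + sqrt (ln (real (card N)) / (2 * real n))"
      using \<delta> M1 by (intro sqrt_add_le) auto
    finally have "2 * b * sqrt (ln (1 / p) / (2 * real n)) \<le>
        2 * b * (sqrt (ln (2 / \<delta>) / (2 * real n)) + sqrt (ln (real (card N)) / (2 * real n)))"
      using b by (intro mult_left_mono) auto
    also have "\<dots> = 2 * b * sqrt (ln (2 / \<delta>) / (2 * real n)) + 2 * b * sqrt (ln (real (card N)) / (2 * real n))"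
      by (simp add: algebra_simps)
    \<comment> \<open>\<open>b\<close> is replaced by \<open>B\<close> in the first term and by
      \<Delta> in the second; with the share of \<open>h0\<close> the confidence term gets the
      factor 3.\<close>
    also have "\<dots> \<le> 2 * B * sqrt (ln (2 / \<delta>) / (2 * real n)) + 2 * \<Delta> * sqrt (ln (real (card N)) / (2 * real n))"
      using b \<delta> M1 by (intro add_mono mult_right_mono) auto
    finally show "(\<integral>z. h z \<partial>D) - (1 / real n) * (\<Sum>i=1..n. h (S i))
         \<le> 3 * B * sqrt (ln (2 / \<delta>) / (2 * real n))
            + 2 * \<Delta> * sqrt (ln (real (card N)) / (2 * real n)) + 2 * \<epsilon>"
      using 1 2 3 4 unfolding dev_def by linarith
  qed
qed

section \<open>Layer matrices\<close>

lemma finite_grid [simp]: "finite (grid d c)"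
  by (simp add: grid_def)

lemma abs_le_L2_set: "finite J \<Longrightarrow> j \<in> J \<Longrightarrow> \<bar>x j\<bar> \<le> L2_set x J"
  using member_le_L2_set[of J j "\<lambda>j. \<bar>x j\<bar>"] by (simp add: L2_set_def)

text \<open>The Euclidean norm is at most the sum of absolute values. The factor is far from sharp;
  it is used for boundedness of the operator and for constants that affect only how large
  \<open>n\<close> has to be.\<close>

lemma L2_set_matvec_le:
  assumes "finite I" "finite J" and b: "\<And>i j. i \<in> I \<Longrightarrow> j \<in> J \<Longrightarrow> \<bar>A i j\<bar> \<le> b"
  shows "L2_set (matvec J A x) I \<le> real (card I * card J) * b * L2_set x J"
proof -
  have "L2_set (matvec J A x) I \<le> (\<Sum>i\<in>I. \<bar>matvec J A x i\<bar>)"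
    by (rule L2_set_le_sum_abs)
  also have "\<dots> \<le> (\<Sum>i\<in>I. \<Sum>j\<in>J. \<bar>A i j\<bar> * \<bar>x j\<bar>)"
    unfolding matvec_def by (intro sum_mono order.trans[OF sum_abs]) (simp add: abs_mult)
  also have "\<dots> \<le> (\<Sum>i\<in>I. \<Sum>j\<in>J. b * L2_set x J)"
    by (intro sum_mono mult_mono b abs_le_L2_set assms) (auto intro: order.trans[OF abs_ge_zero b])
  finally show ?thesis by (simp add: mult_ac)
qed

text \<open>An entry is a coordinate of the image of a unit vector, hence at most the norm of that
  image.\<close>

lemma
  assumes "finite I" "finite J"
  shows spectral_norm_nonneg: "0 \<le> spectral_norm I J A"
    and abs_le_spectral_norm: "i \<in> I \<Longrightarrow> j \<in> J \<Longrightarrow> \<bar>A i j\<bar> \<le> spectral_norm I J A"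
proof -
  \<comment> \<open>Bounding a value by the supremum requires a bounded set; the sum of all absolute
    entries serves as the entry bound.\<close>
  have bdd: "bdd_above ((\<lambda>x. L2_set (matvec J A x) I) ` {x. L2_set x J \<le> 1})"
  proof (rule bdd_aboveI2)
    fix x assume x: "x \<in> {x. L2_set x J \<le> 1}"
    define b where "b = (\<Sum>i\<in>I. \<Sum>j\<in>J. \<bar>A i j\<bar>)"
    have b0: "0 \<le> b" by (simp add: b_def sum_nonneg)
    have "\<bar>A i j\<bar> \<le> b" if "i \<in> I" "j \<in> J" for i j
    proof -
      have "\<bar>A i j\<bar> \<le> (\<Sum>j\<in>J. \<bar>A i j\<bar>)" using assms that by (intro member_le_sum) auto
      also have "\<dots> \<le> b" unfolding b_def using assms that
        by (intro member_le_sum[where f = "\<lambda>i. \<Sum>j\<in>J. \<bar>A i j\<bar>"]) (auto simp: sum_nonneg)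
      finally show ?thesis .
    qed
    hence "L2_set (matvec J A x) I \<le> real (card I * card J) * b * L2_set x J"
      using assms by (intro L2_set_matvec_le)
    also have "\<dots> \<le> real (card I * card J) * b * 1"
      using x b0 by (intro mult_left_mono) auto
    finally show "L2_set (matvec J A x) I \<le> real (card I * card J) * b * 1" .
  qed
  have "L2_set (matvec J A (\<lambda>_. 0)) I \<le> spectral_norm I J A"
    unfolding spectral_norm_def by (rule cSUP_upper[OF _ bdd]) (simp add: L2_set_def)
  thus "0 \<le> spectral_norm I J A" using L2_set_nonneg order.trans by blast
  assume i: "i \<in> I" and j: "j \<in> J"
  let ?e = "\<lambda>k. if k = j then 1 else 0 :: real"
  have e: "L2_set ?e J \<le> 1"
  proof -
    have "(\<Sum>k\<in>J. (?e k)\<^sup>2) = (\<Sum>k\<in>J. ?e k)" by (intro sum.cong) auto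
    thus ?thesis using assms j by (simp add: L2_set_def)
  qed
  have "A i j = matvec J A ?e i"
  proof -
    have "matvec J A ?e i = (\<Sum>k\<in>J. if k = j then A i k else 0)"
      unfolding matvec_def by (intro sum.cong) auto
    thus ?thesis using assms j by simp
  qed
  hence "\<bar>A i j\<bar> \<le> L2_set (matvec J A ?e) I" using abs_le_L2_set[OF assms(1) i, of "matvec J A ?e"] by simp
  also have "\<dots> \<le> spectral_norm I J A"
    unfolding spectral_norm_def using e by (intro cSUP_upper[OF _ bdd]) auto
  finally show "\<bar>A i j\<bar> \<le> spectral_norm I J A" .
qed

section \<open>Convolution as multiplication by a matrix\<close>

lemma zero_pad_unit:
  assumes "s \<in> grid d c" "s = (u, v, k)"
  shows "zero_pad d (\<lambda>t. if t = s then 1 else 0) a b k1 =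
    (if a = int u \<and> b = int v \<and> k1 = k then 1 else 0)"
  using assms by (auto simp: zero_pad_def grid_def)

text \<open>By linearity: the padded input is a combination of unit tensors, and the columns of
  \<open>mt\<close> are their convolutions.\<close>

lemma conv_eq_matvec: "conv d p c K x r = matvec (grid d c) (mt d p c K) x r"
proof -
  obtain i j k' where r: "r = (i, j, k')" by (cases r) auto
  let ?u = "\<lambda>a. int i + int a - int ((p - 1) div 2)"
  let ?v = "\<lambda>b. int j + int b - int ((p - 1) div 2)"
  have zp: "zero_pad d x u v k = (\<Sum>s\<in>grid d c. zero_pad d (\<lambda>t. if t = s then 1 else 0) u v k * x s)"
    if "k < c" for u v k
  proof (cases "0 \<le> u \<and> u < int d \<and> 0 \<le> v \<and> v < int d")
    case True
    have "(\<Sum>s\<in>grid d c. zero_pad d (\<lambda>t. if t = s then 1 else 0) u v k * x s)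
        = (\<Sum>s\<in>grid d c. if s = (nat u, nat v, k) then x s else 0)"
      using True by (intro sum.cong) (auto simp: zero_pad_def)
    also have "\<dots> = x (nat u, nat v, k)"
      using True that by (subst sum.delta) (auto simp: grid_def)
    finally show ?thesis using True by (simp add: zero_pad_def)
  next
    case False
    thus ?thesis by (auto simp: zero_pad_def)
  qed
  have "conv d p c K x r = (\<Sum>a<p. \<Sum>b<p. \<Sum>k<c. \<Sum>s\<in>grid d c.
      K (a, b, k, k') * (zero_pad d (\<lambda>t. if t = s then 1 else 0) (?u a) (?v b) k * x s))"
    unfolding conv_def r by (simp add: zp sum_distrib_left)
  also have "\<dots> = (\<Sum>a<p. \<Sum>b<p. \<Sum>s\<in>grid d c. \<Sum>k<c.
      K (a, b, k, k') * (zero_pad d (\<lambda>t. if t = s then 1 else 0) (?u a) (?v b) k * x s))"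
    by (intro sum.cong refl sum.swap)
  also have "\<dots> = (\<Sum>a<p. \<Sum>s\<in>grid d c. \<Sum>b<p. \<Sum>k<c.
      K (a, b, k, k') * (zero_pad d (\<lambda>t. if t = s then 1 else 0) (?u a) (?v b) k * x s))"
    by (intro sum.cong refl sum.swap)
  also have "\<dots> = (\<Sum>s\<in>grid d c. \<Sum>a<p. \<Sum>b<p. \<Sum>k<c.
      K (a, b, k, k') * (zero_pad d (\<lambda>t. if t = s then 1 else 0) (?u a) (?v b) k * x s))"
    by (rule sum.swap)
  also have "\<dots> = matvec (grid d c) (mt d p c K) x r"
    unfolding matvec_def mt_def conv_def r by (simp add: sum_distrib_right mult.assoc)
  finally show ?thesis .
qed

text \<open>The input and output positions determine the kernel offset, so at most one term of the
  sum survives, and its index \<open>e\<close> is the same for every kernel. This reduces closeness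
  of convolution matrices to closeness of kernel entries.\<close>

lemma mt_cases:
  assumes r: "r \<in> grid d c'" and s: "s \<in> grid d c"
  obtains "\<And>K. mt d p c K r s = 0"
  | e where "e \<in> {..<p} \<times> {..<p} \<times> {..<c} \<times> {..<c'}" "\<And>K. mt d p c K r s = K e"
proof -
  obtain i j k' where r': "r = (i, j, k')" by (cases r) auto
  obtain u v k where s': "s = (u, v, k)" by (cases s) auto
  have k: "k < c" "k' < c'" using r s r' s' by (auto simp: grid_def)
  \<comment> \<open>Integers are used because the offset can be negative; outside the range of the
    kernel the entry is 0 for all kernels.\<close>
  define a0 where "a0 = int u - int i + int ((p - 1) div 2)"
  define b0 where "b0 = int v - int j + int ((p - 1) div 2)"
  have eq: "mt d p c K r s = (\<Sum>a<p. \<Sum>b<p. \<Sum>k1<c. if int a = a0 \<and> int b = b0 \<and> k1 = k then K (a, b, k, k') else 0)" for K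
    unfolding mt_def conv_def r' split
    by (intro sum.cong refl) (auto simp: zero_pad_unit[OF s s', folded r'] a0_def b0_def)
  show ?thesis
  proof (cases "0 \<le> a0 \<and> a0 < int p \<and> 0 \<le> b0 \<and> b0 < int p")
    case True
    have "mt d p c K r s = K (nat a0, nat b0, k, k')" for K
    proof -
      have "mt d p c K r s = (\<Sum>a<p. \<Sum>b<p. \<Sum>k1<c. if k1 = k then (if b = nat b0 then (if a = nat a0 then K (a, b, k, k') else 0) else 0) else 0)"
        unfolding eq using True by (intro sum.cong refl) auto
      also have "\<dots> = (\<Sum>a<p. \<Sum>b<p. (if b = nat b0 then (if a = nat a0 then K (a, b, k, k') else 0) else 0))"
        using k by simp
      also have "\<dots> = (\<Sum>a<p. (if a = nat a0 then K (a, nat b0, k, k') else 0))"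
        using True by (intro sum.cong refl) (subst sum.delta; auto)
      also have "\<dots> = K (nat a0, nat b0, k, k')"
        using True by (subst sum.delta) auto
      finally show ?thesis .
    qed
    moreover have "(nat a0, nat b0, k, k') \<in> {..<p} \<times> {..<p} \<times> {..<c} \<times> {..<c'}"
      using True k by auto
    ultimately show ?thesis using that(2) by blast
  next
    case False
    have "mt d p c K r s = 0" for K
      unfolding eq using False by (intro sum.neutral ballI) auto
    thus ?thesis by (rule that(1))
  qed
qed

section \<open>Lipschitz dependence on input and parameters\<close>

lemma one_Lipschitz_compose:
  assumes "one_Lipschitz J I g" "one_Lipschitz I H h"
  shows "one_Lipschitz J H (\<lambda>x. h (g x))"
  using assms unfolding one_Lipschitz_def by (meson order.trans)

text \<open>
  The relation \<open>near \<eta>\<close> stands for parameters at distance at most \<open>\<eta>\<close>. The bound \<open>R'\<close> on the outputs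
  is what makes the property closed under composition.
\<close>

definition Lipschitz_family ::
  "'j set \<Rightarrow> 'i set \<Rightarrow> 'p set \<Rightarrow> (real \<Rightarrow> 'p \<Rightarrow> 'p \<Rightarrow> bool) \<Rightarrow> ('p \<Rightarrow> ('j \<Rightarrow> real) \<Rightarrow> ('i \<Rightarrow> real)) \<Rightarrow> bool" where
  "Lipschitz_family J I T near F \<longleftrightarrow>
     (\<forall>R. \<exists>R' M. 0 \<le> M \<and> (\<forall>\<theta>\<in>T. \<forall>\<theta>'\<in>T. \<forall>\<eta>\<ge>0. near \<eta> \<theta> \<theta>' \<longrightarrow>
        (\<forall>x x'. L2_set x J \<le> R \<longrightarrow> L2_set (F \<theta> x) I \<le> R' \<and>
           L2_set (\<lambda>i. F \<theta> x i - F \<theta>' x' i) I \<le> M * (\<eta> + L2_set (\<lambda>j. x j - x' j) J))))"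

lemma Lipschitz_familyE:
  assumes "Lipschitz_family J I T near F"
  obtains M R' where "0 \<le> M" "\<And>\<theta> \<theta>' \<eta> x x'. \<lbrakk>\<theta> \<in> T; \<theta>' \<in> T; 0 \<le> \<eta>; near \<eta> \<theta> \<theta>'; L2_set x J \<le> R\<rbrakk> \<Longrightarrow>
      L2_set (F \<theta> x) I \<le> R' \<and> L2_set (\<lambda>i. F \<theta> x i - F \<theta>' x' i) I \<le> M * (\<eta> + L2_set (\<lambda>j. x j - x' j) J)"
  using assms unfolding Lipschitz_family_def by meson

lemma Lipschitz_family_id:
  "Lipschitz_family J J T near (\<lambda>\<theta> x. x)"
  unfolding Lipschitz_family_def
proof
  fix R :: real
  show "\<exists>R' M. 0 \<le> M \<and> (\<forall>\<theta>\<in>T. \<forall>\<theta>'\<in>T. \<forall>\<eta>\<ge>0. near \<eta> \<theta> \<theta>' \<longrightarrow>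
        (\<forall>x x'. L2_set x J \<le> R \<longrightarrow> L2_set x J \<le> R' \<and>
           L2_set (\<lambda>i. x i - x' i) J \<le> M * (\<eta> + L2_set (\<lambda>j. x j - x' j) J)))"
    by (rule exI[of _ R], rule exI[of _ 1]) auto
qed

text \<open>The output bound \<open>R1\<close> of \<open>F\<close> becomes the input radius for
  \<open>G\<close>. A parameter change acts in \<open>G\<close> directly and through
  \<open>F\<close>, which gives the constant \<open>M2 * (1 + M1)\<close>.\<close>

lemma Lipschitz_family_compose:
  assumes F: "Lipschitz_family J I T near F" and G: "Lipschitz_family I H T near G"
  shows "Lipschitz_family J H T near (\<lambda>\<theta> x. G \<theta> (F \<theta> x))"
  unfolding Lipschitz_family_def
proof
  fix R :: real
  obtain M1 R1 where 1: "0 \<le> M1" "\<And>\<theta> \<theta>' \<eta> x x'. \<lbrakk>\<theta> \<in> T; \<theta>' \<in> T; 0 \<le> \<eta>; near \<eta> \<theta> \<theta>'; L2_set x J \<le> R\<rbrakk> \<Longrightarrow>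
      L2_set (F \<theta> x) I \<le> R1 \<and> L2_set (\<lambda>i. F \<theta> x i - F \<theta>' x' i) I \<le> M1 * (\<eta> + L2_set (\<lambda>j. x j - x' j) J)"
    using F by (rule Lipschitz_familyE[where R = R]) (rule that)
  obtain M2 R2 where 2: "0 \<le> M2" "\<And>\<theta> \<theta>' \<eta> x x'. \<lbrakk>\<theta> \<in> T; \<theta>' \<in> T; 0 \<le> \<eta>; near \<eta> \<theta> \<theta>'; L2_set x I \<le> R1\<rbrakk> \<Longrightarrow>
      L2_set (G \<theta> x) H \<le> R2 \<and> L2_set (\<lambda>i. G \<theta> x i - G \<theta>' x' i) H \<le> M2 * (\<eta> + L2_set (\<lambda>j. x j - x' j) I)"
    using G by (rule Lipschitz_familyE[where R = R1]) (rule that)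
  show "\<exists>R' M. 0 \<le> M \<and> (\<forall>\<theta>\<in>T. \<forall>\<theta>'\<in>T. \<forall>\<eta>\<ge>0. near \<eta> \<theta> \<theta>' \<longrightarrow>
        (\<forall>x x'. L2_set x J \<le> R \<longrightarrow> L2_set (G \<theta> (F \<theta> x)) H \<le> R' \<and>
           L2_set (\<lambda>i. G \<theta> (F \<theta> x) i - G \<theta>' (F \<theta>' x') i) H \<le> M * (\<eta> + L2_set (\<lambda>j. x j - x' j) J)))"
  proof (rule exI[of _ R2], rule exI[of _ "M2 * (1 + M1)"], intro conjI ballI allI impI)
    fix \<theta> \<theta>' \<eta> x x' assume a: "\<theta> \<in> T" "\<theta>' \<in> T" "0 \<le> \<eta>" "near \<eta> \<theta> \<theta>'" "L2_set x J \<le> R"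
    note f = 1(2)[OF a]
    note g = 2(2)[OF a(1-4) conjunct1[OF f[of x']], of "F \<theta>' x'"]
    show "L2_set (G \<theta> (F \<theta> x)) H \<le> R2" using g by blast
    have "L2_set (\<lambda>i. G \<theta> (F \<theta> x) i - G \<theta>' (F \<theta>' x') i) H
        \<le> M2 * (\<eta> + L2_set (\<lambda>i. F \<theta> x i - F \<theta>' x' i) I)" using g by blast
    also have "\<dots> \<le> M2 * ((\<eta> + L2_set (\<lambda>j. x j - x' j) J) + M1 * (\<eta> + L2_set (\<lambda>j. x j - x' j) J))"
      using f[of x'] 2(1) by (intro mult_left_mono add_mono) auto
    finally show "L2_set (\<lambda>i. G \<theta> (F \<theta> x) i - G \<theta>' (F \<theta>' x') i) H
        \<le> M2 * (1 + M1) * (\<eta> + L2_set (\<lambda>j. x j - x' j) J)" by (simp add: algebra_simps)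
  qed (use 1 2 in auto)
qed

text \<open>Rests on \<open>A x - A' x' = (A - A') x + A' (x - x')\<close>, where only
  \<open>x\<close> has to be bounded. The map \<open>y\<close> stands for a convolution or a matrix
  product.\<close>

lemma Lipschitz_family_layer:
  assumes fin: "finite I" "finite J" and g: "one_Lipschitz I I' g"
    and b: "\<And>\<theta> i j. \<theta> \<in> T \<Longrightarrow> i \<in> I \<Longrightarrow> j \<in> J \<Longrightarrow> \<bar>A \<theta> i j\<bar> \<le> b"
    and near: "\<And>\<theta> \<theta>' \<eta> i j. near \<eta> \<theta> \<theta>' \<Longrightarrow> i \<in> I \<Longrightarrow> j \<in> J \<Longrightarrow> \<bar>A \<theta> i j - A \<theta>' i j\<bar> \<le> \<eta>"
    and y: "\<And>\<theta> x i. i \<in> I \<Longrightarrow> y \<theta> x i = matvec J (A \<theta>) x i"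
  shows "Lipschitz_family J I' T near (\<lambda>\<theta> x. g (y \<theta> x))"
  unfolding Lipschitz_family_def
proof
  fix R :: real
  define n where "n = real (card I * card J)"
  \<comment> \<open>The maxima keep the constants nonnegative when \<open>b\<close> or
    \<open>R\<close> is negative; the conditions stated with them are then vacuous.\<close>
  define c where "c = max b 0"
  define R' where "R' = max R 0"
  have b': "\<bar>A \<theta> i j\<bar> \<le> c" if "\<theta> \<in> T" "i \<in> I" "j \<in> J" for \<theta> i j
    using b[OF that] by (simp add: c_def)
  have n: "0 \<le> n" by (simp add: n_def)
  have g': "L2_set (\<lambda>i. g u i - g v i) I' \<le> L2_set (\<lambda>i. u i - v i) I" for u v
    using g by (simp add: one_Lipschitz_def)
  show "\<exists>R' M. 0 \<le> M \<and> (\<forall>\<theta>\<in>T. \<forall>\<theta>'\<in>T. \<forall>\<eta>\<ge>0. near \<eta> \<theta> \<theta>' \<longrightarrow>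
        (\<forall>x x'. L2_set x J \<le> R \<longrightarrow> L2_set (g (y \<theta> x)) I' \<le> R' \<and>
           L2_set (\<lambda>i. g (y \<theta> x) i - g (y \<theta>' x') i) I' \<le> M * (\<eta> + L2_set (\<lambda>j. x j - x' j) J)))"
  \<comment> \<open>An activation may move 0, so the norm of its value there is part of the output
    bound.\<close>
  proof (rule exI[of _ "n * c * R' + L2_set (g (\<lambda>_. 0)) I'"], rule exI[of _ "n * R' + n * c"], intro conjI ballI allI impI)
    fix \<theta> \<theta>' \<eta> x x' assume a: "\<theta> \<in> T" "\<theta>' \<in> T" "0 \<le> \<eta>" "near \<eta> \<theta> \<theta>'" "L2_set x J \<le> R"
    have R: "L2_set x J \<le> R'" using a by (simp add: R'_def)
    have "L2_set (g (y \<theta> x)) I' = L2_set (\<lambda>i. (g (y \<theta> x) i - g (\<lambda>_. 0) i) + g (\<lambda>_. 0) i) I'" by simp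
    also have "\<dots> \<le> L2_set (\<lambda>i. g (y \<theta> x) i - g (\<lambda>_. 0) i) I' + L2_set (g (\<lambda>_. 0)) I'"
      by (rule L2_set_triangle_ineq)
    also have "L2_set (\<lambda>i. g (y \<theta> x) i - g (\<lambda>_. 0) i) I' \<le> L2_set (\<lambda>i. y \<theta> x i - 0) I" by (rule g')
    also have "\<dots> = L2_set (matvec J (A \<theta>) x) I" using y by (intro L2_set_cong) auto
    also have "\<dots> \<le> n * c * L2_set x J" unfolding n_def
      by (intro L2_set_matvec_le fin b' a)
    also have "\<dots> \<le> n * c * R'" using R n by (intro mult_left_mono) (auto simp: c_def)
    finally show "L2_set (g (y \<theta> x)) I' \<le> n * c * R' + L2_set (g (\<lambda>_. 0)) I'" by simp
    have "L2_set (\<lambda>i. g (y \<theta> x) i - g (y \<theta>' x') i) I' \<le> L2_set (\<lambda>i. y \<theta> x i - y \<theta>' x' i) I" by (rule g')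
    also have "\<dots> = L2_set (\<lambda>i. matvec J (\<lambda>i j. A \<theta> i j - A \<theta>' i j) x i
        + matvec J (A \<theta>') (\<lambda>j. x j - x' j) i) I"
      using y by (intro L2_set_cong refl) (auto simp: matvec_def algebra_simps simp flip: sum.distrib sum_subtractf)
    also have "\<dots> \<le> L2_set (matvec J (\<lambda>i j. A \<theta> i j - A \<theta>' i j) x) I
        + L2_set (matvec J (A \<theta>') (\<lambda>j. x j - x' j)) I"
      by (rule L2_set_triangle_ineq)
    also have "\<dots> \<le> n * \<eta> * L2_set x J + n * c * L2_set (\<lambda>j. x j - x' j) J"
      unfolding n_def by (intro add_mono L2_set_matvec_le fin b' a near[OF a(4)])
    also have "\<dots> \<le> n * \<eta> * R' + n * c * L2_set (\<lambda>j. x j - x' j) J"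
      using R n a(3) by (intro add_right_mono mult_left_mono mult_nonneg_nonneg)
    also have "\<dots> \<le> (n * R' + n * c) * (\<eta> + L2_set (\<lambda>j. x j - x' j) J)"
    proof -
      have "0 \<le> n * c * \<eta>" "0 \<le> n * R' * L2_set (\<lambda>j. x j - x' j) J" using n a(3) by (auto simp: R'_def c_def)
      thus ?thesis by (simp add: algebra_simps)
    qed
    finally show "L2_set (\<lambda>i. g (y \<theta> x) i - g (y \<theta>' x') i) I' \<le> (n * R' + n * c) * (\<eta> + L2_set (\<lambda>j. x j - x' j) J)" .
  qed (use n in \<open>auto simp: R'_def c_def\<close>)
qed

section \<open>Vectorization of tensors\<close>

lemma bij_betw_tvec_index:
  "bij_betw (\<lambda>m. ((m - 1) div (d * c), (m - 1) div c mod d, (m - 1) mod c)) {1..d * d * c} (grid d c)"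
\<comment> \<open>In the inverse the channel index runs fastest; the summand 1 is there because
  vectors are indexed from 1.\<close>
proof (rule bij_betwI[where g = "\<lambda>(i, j, k). i * (d * c) + j * c + k + 1"])
  show "(\<lambda>m. ((m - 1) div (d * c), (m - 1) div c mod d, (m - 1) mod c)) \<in> {1..d * d * c} \<rightarrow> grid d c"
  proof
    fix m assume m: "m \<in> {1..d * d * c}"
    hence "d \<noteq> 0" "c \<noteq> 0" "m - 1 < d * (d * c)" by (auto simp: mult_ac intro!: gr0I)
    thus "((m - 1) div (d * c), (m - 1) div c mod d, (m - 1) mod c) \<in> grid d c"
      by (auto simp: grid_def less_mult_imp_div_less)
  qed
  show "(\<lambda>(i, j, k). i * (d * c) + j * c + k + 1) \<in> grid d c \<rightarrow> {1..d * d * c}"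
  proof
    fix t assume "t \<in> grid d c"
    then obtain i j k where t: "t = (i, j, k)" "i < d" "j < d" "k < c" by (auto simp: grid_def)
    have "j * c + k < d * c" using mult_le_mono1[of "Suc j" d c] t(3,4) by simp
    hence "i * (d * c) + (j * c + k) < d * (d * c)" using mult_le_mono1[of "Suc i" d "d * c"] t(2) by simp
    thus "(case t of (i, j, k) \<Rightarrow> i * (d * c) + j * c + k + 1) \<in> {1..d * d * c}"
      by (simp add: t mult_ac)
  qed
  fix m assume m: "m \<in> {1..d * d * c}"
  have "(m - 1) div (d * c) = (m - 1) div c div d" by (metis div_mult2_eq mult.commute)
  hence "(m - 1) div (d * c) * (d * c) + (m - 1) div c mod d * c + (m - 1) mod c
      = ((m - 1) div c div d * d + (m - 1) div c mod d) * c + (m - 1) mod c"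
    by (simp only: add_mult_distrib mult.assoc)
  also have "\<dots> = m - 1" by (simp only: div_mult_mod_eq)
  finally show "(case ((m - 1) div (d * c), (m - 1) div c mod d, (m - 1) mod c) of
      (i, j, k) \<Rightarrow> i * (d * c) + j * c + k + 1) = m" using m by simp
next
  fix t assume "t \<in> grid d c"
  then obtain i j k where t: "t = (i, j, k)" "i < d" "j < d" "k < c" by (auto simp: grid_def)
  have 1: "(i * (d * c) + j * c + k) div c = i * d + j"
  proof -
    have "i * (d * c) + j * c + k = (i * d + j) * c + k" by (simp add: algebra_simps)
    thus ?thesis using t by simp
  qed
  have 2: "(i * (d * c) + j * c + k) mod c = k"
  proof -
    have "i * (d * c) + j * c + k = (i * d + j) * c + k" by (simp add: algebra_simps)
    thus ?thesis using t by simp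
  qed
  have 3: "(i * (d * c) + j * c + k) div (d * c) = i"
    using 1 t by (metis div_mult2_eq mult.commute div_mult_self3 div_less add.right_neutral add_0 less_nat_zero_code mult_0_right)
  show "(((case t of (i, j, k) \<Rightarrow> i * (d * c) + j * c + k + 1) - 1) div (d * c),
         ((case t of (i, j, k) \<Rightarrow> i * (d * c) + j * c + k + 1) - 1) div c mod d,
         ((case t of (i, j, k) \<Rightarrow> i * (d * c) + j * c + k + 1) - 1) mod c) = t"
    using 1 2 3 t by simp
qed

lemma L2_set_tvec: "L2_set (tvec d c x) {1..d * d * c} = L2_set x (grid d c)"
proof -
  have "(\<Sum>m=1..d * d * c. (tvec d c x m)\<^sup>2) = (\<Sum>t\<in>grid d c. (x t)\<^sup>2)"
    using sum.reindex_bij_betw[OF bij_betw_tvec_index, of "\<lambda>t. (x t)\<^sup>2" d c] by (simp add: tvec_def)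
  thus ?thesis by (simp add: L2_set_def)
qed

text \<open>Vectorization relabels the entries, so it is an isometry and inherits the constants of
  the identity.\<close>

lemma Lipschitz_family_tvec:
  "Lipschitz_family (grid d c) {1..d * d * c} T near (\<lambda>\<theta>. tvec d c)"
proof -
  have "L2_set (\<lambda>i. tvec d c x i - tvec d c x' i) {1..d * d * c} = L2_set (\<lambda>t. x t - x' t) (grid d c)" for x x'
    by (subst L2_set_tvec[symmetric], rule L2_set_cong[OF refl]) (simp add: tvec_def)
  hence eq: "L2_set (tvec d c x) {1..d * d * c} = L2_set x (grid d c)"
    "L2_set (\<lambda>i. tvec d c x i - tvec d c x' i) {1..d * d * c} = L2_set (\<lambda>t. x t - x' t) (grid d c)" for x x'
    by (simp_all only: L2_set_tvec)
  show ?thesis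
    using Lipschitz_family_id[of "grid d c" T near] unfolding Lipschitz_family_def eq .
qed

text \<open>Closeness refers to the entries of the layer matrices, because a kernel entry that only
  meets the padding is not controlled by \<open>param_dist\<close>.\<close>

definition params_near ::
  "cnn_arch \<Rightarrow> real \<Rightarrow> (nat \<Rightarrow> kernel) \<times> (nat \<Rightarrow> nat \<Rightarrow> nat \<Rightarrow> real) \<Rightarrow>
    (nat \<Rightarrow> kernel) \<times> (nat \<Rightarrow> nat \<Rightarrow> nat \<Rightarrow> real) \<Rightarrow> bool" where
  "params_near A \<eta> \<theta> \<theta>' \<longleftrightarrow>
     (\<forall>l\<in>{1..convs A}. \<forall>r\<in>grid (side A (l - 1)) (chan A l). \<forall>s\<in>grid (side A (l - 1)) (chan A (l - 1)).
        \<bar>conv_mat A l (fst \<theta> l) r s - conv_mat A l (fst \<theta>' l) r s\<bar> \<le> \<eta>) \<and>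
     (\<forall>l\<in>{1..fulls A}. \<forall>i\<in>{1..width A l}. \<forall>j\<in>{1..width A (l - 1)}.
        \<bar>snd \<theta> l i j - snd \<theta>' l i j\<bar> \<le> \<eta>)"

text \<open>All summands of \<open>param_dist\<close> are nonnegative, so each is at most \<beta>,
  and a spectral norm dominates the entries.\<close>

lemma params_near_param_dist:
  assumes "param_dist A KN V KN0 V0 \<le> \<beta>"
  shows "params_near A \<beta> (KN, V) (KN0, V0)"
proof -
  let ?c = "\<lambda>l. conv_norm A l (\<lambda>r s. conv_mat A l (KN l) r s - conv_mat A l (KN0 l) r s)"
  let ?f = "\<lambda>l. full_norm A l (\<lambda>i j. V l i j - V0 l i j)"
  have c0: "0 \<le> ?c l" and f0: "0 \<le> ?f l" for l
    by (simp_all add: conv_norm_def full_norm_def spectral_norm_nonneg)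
  have sums: "0 \<le> (\<Sum>l=1..convs A. ?c l)" "0 \<le> (\<Sum>l=1..fulls A. ?f l)"
    by (intro sum_nonneg c0 f0)+
  have d: "(\<Sum>l=1..convs A. ?c l) + (\<Sum>l=1..fulls A. ?f l) \<le> \<beta>"
    using assms by (simp add: param_dist_def)
  have c: "?c l \<le> \<beta>" if "l \<in> {1..convs A}" for l
    using member_le_sum[of l "{1..convs A}" ?c] c0 that sums d by fastforce
  have f: "?f l \<le> \<beta>" if "l \<in> {1..fulls A}" for l
    using member_le_sum[of l "{1..fulls A}" ?f] f0 that sums d by fastforce
  show ?thesis
    unfolding params_near_def fst_conv snd_conv
  proof (intro conjI ballI)
    fix l r s assume l: "l \<in> {1..convs A}"
      and rs: "r \<in> grid (side A (l - 1)) (chan A l)" "s \<in> grid (side A (l - 1)) (chan A (l - 1))"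
    show "\<bar>conv_mat A l (KN l) r s - conv_mat A l (KN0 l) r s\<bar> \<le> \<beta>"
      by (rule order.trans[OF abs_le_spectral_norm[OF finite_grid finite_grid rs] c[OF l, unfolded conv_norm_def]])
  next
    fix l i j assume l: "l \<in> {1..fulls A}" and ij: "i \<in> {1..width A l}" "j \<in> {1..width A (l - 1)}"
    show "\<bar>V l i j - V0 l i j\<bar> \<le> \<beta>"
      by (rule order.trans[OF abs_le_spectral_norm[OF finite_atLeastAtMost finite_atLeastAtMost ij] f[OF l, unfolded full_norm_def]])
  qed
qed

lemma spectral_norm_0: "spectral_norm I J (\<lambda>i j. 0) = 0"
proof -
  have "(\<lambda>x. L2_set (matvec J (\<lambda>i j. 0) x) I) ` {x. L2_set x J \<le> 1} = {0}"
    by (auto simp: matvec_def L2_set_def image_iff intro!: exI[of _ "\<lambda>_. 0"])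
  thus ?thesis by (simp add: spectral_norm_def)
qed

text \<open>Puts the initial parameters into the class, which is therefore nonempty.\<close>

lemma param_dist_refl: "param_dist A KN V KN V = 0"
  by (simp add: param_dist_def conv_norm_def full_norm_def spectral_norm_0)

lemma bounded_entries:
  fixes A0 :: "'i \<Rightarrow> 'j \<Rightarrow> real"
  assumes "finite I" "finite J"
  obtains b where "\<And>A i j. i \<in> I \<Longrightarrow> j \<in> J \<Longrightarrow> \<bar>A i j - A0 i j\<bar> \<le> \<beta> \<Longrightarrow> \<bar>A i j\<bar> \<le> b"
proof
  fix A :: "'i \<Rightarrow> 'j \<Rightarrow> real" and i j assume a: "i \<in> I" "j \<in> J" "\<bar>A i j - A0 i j\<bar> \<le> \<beta>"
  have "\<bar>A0 i j\<bar> \<le> spectral_norm I J A0" using a by (intro abs_le_spectral_norm assms)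
  thus "\<bar>A i j\<bar> \<le> \<beta> + spectral_norm I J A0" using a(3) by linarith
qed

text \<open>Induction over the layers, composing with one more layer each time. Restricting the
  parameters to a ball around \<open>\<theta>0\<close> provides the entry bounds that
  \<open>Lipschitz_family_layer\<close> asks for.\<close>

lemma Lipschitz_family_cnn:
  assumes A: "is_cnn_arch A d c C"
  shows "Lipschitz_family (grid d c) {1..C} {\<theta>. params_near A \<beta> \<theta> \<theta>0} (params_near A)
           (\<lambda>\<theta>. cnn A (fst \<theta>) (snd \<theta>))"
proof -
  let ?T = "{\<theta>. params_near A \<beta> \<theta> \<theta>0}"
  have conv: "Lipschitz_family (grid d c) (grid (side A l) (chan A l)) ?T (params_near A)
      (\<lambda>\<theta>. conv_layers A (fst \<theta>) l)" if "l \<le> convs A" for l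
    using that
  proof (induction l)
    case 0
    show ?case using A Lipschitz_family_id[of "grid d c"] by (simp add: is_cnn_arch_def)
  next
    case (Suc l)
    let ?J = "grid (side A l) (chan A l)" and ?I = "grid (side A l) (chan A (Suc l))"
    obtain b where b: "\<And>M r s. r \<in> ?I \<Longrightarrow> s \<in> ?J \<Longrightarrow>
        \<bar>M r s - conv_mat A (Suc l) (fst \<theta>0 (Suc l)) r s\<bar> \<le> \<beta> \<Longrightarrow> \<bar>M r s\<bar> \<le> b"
      by (rule bounded_entries[of ?I ?J "conv_mat A (Suc l) (fst \<theta>0 (Suc l))" \<beta>]) auto
    have l: "Suc l \<in> {1..convs A}" using Suc.prems by simp
    have g: "one_Lipschitz ?I (grid (side A (Suc l)) (chan A (Suc l))) (\<lambda>x. pool A (Suc l) (cact A (Suc l) x))"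
    proof (rule one_Lipschitz_compose[where g = "cact A (Suc l)" and h = "pool A (Suc l)" and I = ?I])
      have "one_Lipschitz (grid (side A (Suc l - 1)) (chan A (Suc l))) (grid (side A (Suc l - 1)) (chan A (Suc l))) (cact A (Suc l)) \<and>
        one_Lipschitz (grid (side A (Suc l - 1)) (chan A (Suc l))) (grid (side A (Suc l)) (chan A (Suc l))) (pool A (Suc l))"
        using A l unfolding is_cnn_arch_def by blast
      thus "one_Lipschitz ?I ?I (cact A (Suc l))" "one_Lipschitz ?I (grid (side A (Suc l)) (chan A (Suc l))) (pool A (Suc l))"
        by simp_all
    qed
    have "Lipschitz_family ?J (grid (side A (Suc l)) (chan A (Suc l))) ?T (params_near A)
        (\<lambda>\<theta> x. pool A (Suc l) (cact A (Suc l)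
            (conv (side A l) (ksize A (Suc l)) (chan A l) (fst \<theta> (Suc l)) x)))"
    proof (rule Lipschitz_family_layer[where g = "\<lambda>x. pool A (Suc l) (cact A (Suc l) x)" and I = ?I
          and A = "\<lambda>\<theta>. conv_mat A (Suc l) (fst \<theta> (Suc l))" and b = b
          and y = "\<lambda>\<theta>. conv (side A l) (ksize A (Suc l)) (chan A l) (fst \<theta> (Suc l))"])
      show "conv (side A l) (ksize A (Suc l)) (chan A l) (fst \<theta> (Suc l)) x r
          = matvec ?J (conv_mat A (Suc l) (fst \<theta> (Suc l))) x r" for \<theta> :: "(nat \<Rightarrow> kernel) \<times> (nat \<Rightarrow> nat \<Rightarrow> nat \<Rightarrow> real)" and x r
        by (simp add: conv_eq_matvec conv_mat_def)
    next
      fix \<theta> r s assume "\<theta> \<in> ?T" "r \<in> ?I" "s \<in> ?J"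
      thus "\<bar>conv_mat A (Suc l) (fst \<theta> (Suc l)) r s\<bar> \<le> b"
        using l by (intro b) (auto simp: params_near_def)
    next
      fix \<theta> \<theta>' \<eta> r s assume "params_near A \<eta> \<theta> \<theta>'" "r \<in> ?I" "s \<in> ?J"
      thus "\<bar>conv_mat A (Suc l) (fst \<theta> (Suc l)) r s - conv_mat A (Suc l) (fst \<theta>' (Suc l)) r s\<bar> \<le> \<eta>"
        using l by (auto simp: params_near_def)
    qed (use g in auto)
    from Lipschitz_family_compose[OF Suc.IH this] Suc.prems show ?case by simp
  qed
  have full: "Lipschitz_family {1..width A 0} {1..width A l} ?T (params_near A)
      (\<lambda>\<theta>. full_layers A (snd \<theta>) l)" if "l \<le> fulls A" for l
    using that
  proof (induction l)
    case 0
    show ?case using Lipschitz_family_id[of "{1..width A 0}"] by simp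
  next
    case (Suc l)
    let ?J = "{1..width A l}" and ?I = "{1..width A (Suc l)}"
    obtain b where b: "\<And>M r s. r \<in> ?I \<Longrightarrow> s \<in> ?J \<Longrightarrow> \<bar>M r s - snd \<theta>0 (Suc l) r s\<bar> \<le> \<beta> \<Longrightarrow> \<bar>M r s\<bar> \<le> b"
      by (rule bounded_entries[of ?I ?J "snd \<theta>0 (Suc l)" \<beta>]) auto
    have l: "Suc l \<in> {1..fulls A}" using Suc.prems by simp
    have "Lipschitz_family ?J ?I ?T (params_near A) (\<lambda>\<theta> x. fcact A (Suc l) (matvec ?J (snd \<theta> (Suc l)) x))"
    proof (rule Lipschitz_family_layer[where I = ?I and A = "\<lambda>\<theta>. snd \<theta> (Suc l)" and b = b
          and g = "fcact A (Suc l)" and y = "\<lambda>\<theta>. matvec ?J (snd \<theta> (Suc l))"])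
      show "one_Lipschitz ?I ?I (fcact A (Suc l))" using A l unfolding is_cnn_arch_def by blast
    next
      fix \<theta> r s assume "\<theta> \<in> ?T" "r \<in> ?I" "s \<in> ?J"
      thus "\<bar>snd \<theta> (Suc l) r s\<bar> \<le> b"
        using l by (intro b) (auto simp: params_near_def)
    next
      fix \<theta> \<theta>' \<eta> r s assume "params_near A \<eta> \<theta> \<theta>'" "r \<in> ?I" "s \<in> ?J"
      thus "\<bar>snd \<theta> (Suc l) r s - snd \<theta>' (Suc l) r s\<bar> \<le> \<eta>"
        using l by (auto simp: params_near_def)
    qed auto
    from Lipschitz_family_compose[OF Suc.IH this] Suc.prems show ?case by simp
  qed
  let ?n = "side A (convs A)" and ?k = "chan A (convs A)"
  have w: "width A 0 = ?n * ?n * ?k" "width A (fulls A) = C"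
    using A by (auto simp: is_cnn_arch_def)
  show ?thesis
    using Lipschitz_family_compose[OF Lipschitz_family_compose[OF conv[OF order.refl] Lipschitz_family_tvec]
        full[OF order.refl, unfolded w]]
    unfolding cnn_def .
qed

section \<open>Nets of the class\<close>

text \<open>Together with \<open>full_index\<close> it has one element per scalar parameter, so that
  a rounding of all parameters is a function on these sets.\<close>

definition conv_index :: "cnn_arch \<Rightarrow> (nat \<times> nat \<times> nat \<times> nat \<times> nat) set" where
  "conv_index A = (SIGMA l:{1..convs A}. {..<ksize A l} \<times> {..<ksize A l} \<times> {..<chan A (l - 1)} \<times> {..<chan A l})"

definition full_index :: "cnn_arch \<Rightarrow> (nat \<times> nat \<times> nat) set" where
  "full_index A = (SIGMA l:{1..fulls A}. {1..width A l} \<times> {1..width A (l - 1)})"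

lemma finite_index [simp]: "finite (conv_index A)" "finite (full_index A)"
  by (auto simp: conv_index_def full_index_def)

lemma num_params_eq: "num_params A = card (conv_index A) + card (full_index A)"
  by (simp add: num_params_def conv_index_def full_index_def card_SigmaI card_cartesian_product mult_ac)

text \<open>
  A kernel entry that only ever meets the padding is not controlled by \<^const>\<open>param_dist\<close> and may be
  arbitrarily far from its initial value. It has no influence on the network, so all values outside
  \<open>[-\<beta>, \<beta>]\<close> can share a cell.
\<close>

definition cell_index :: "real \<Rightarrow> nat \<Rightarrow> real \<Rightarrow> int" where
  "cell_index \<beta> n t = (if \<bar>t\<bar> \<le> \<beta> then \<lfloor>t * real n\<rfloor> else 0)"

lemma cell_index_range: "cell_index \<beta> n t \<in> {- int (nat \<lceil>\<beta>\<rceil> * n)..int (nat \<lceil>\<beta>\<rceil> * n)}"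
proof (cases "\<bar>t\<bar> \<le> \<beta>")
  case True
  define m where "m = nat \<lceil>\<beta>\<rceil>"
  have "\<bar>t\<bar> \<le> real m" using True unfolding m_def by linarith
  hence "\<bar>t * real n\<bar> \<le> real m * real n" by (simp add: abs_mult mult_right_mono)
  hence "- real m * real n \<le> t * real n" "t * real n \<le> real m * real n" by (auto simp: abs_le_iff)
  hence "of_int (- int (m * n)) \<le> t * real n" "t * real n \<le> of_int (int (m * n))" by auto
  thus ?thesis using True unfolding cell_index_def m_def[symmetric] by (auto simp: le_floor_iff floor_le_iff)
qed (auto simp: cell_index_def)

text \<open>The bounds by \<beta> exclude the default cell of far values, so equal cells mean equal
  floors.\<close>

lemma cell_index_eqD:
  assumes "cell_index \<beta> n s = cell_index \<beta> n t" "\<bar>s\<bar> \<le> \<beta>" "\<bar>t\<bar> \<le> \<beta>" "n \<ge> 1"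
  shows "\<bar>s - t\<bar> \<le> 1 / real n"
proof -
  have "\<lfloor>s * real n\<rfloor> = \<lfloor>t * real n\<rfloor>" using assms by (simp add: cell_index_def)
  hence "\<bar>s * real n - t * real n\<bar> \<le> 1" by linarith
  hence "\<bar>s - t\<bar> * real n \<le> 1" by (simp add: abs_mult left_diff_distrib[symmetric])
  thus ?thesis using assms by (simp add: field_simps)
qed

text \<open>The representatives are chosen in \<open>X\<close> itself. This makes the net a subset
  of the class, where losses are measurable and the bound on score differences applies.\<close>

lemma finite_representatives:
  assumes "finite Y" "c ` X \<subseteq> Y"
  obtains X0 where "X0 \<subseteq> X" "finite X0" "card X0 \<le> card Y" "\<And>x. x \<in> X \<Longrightarrow> \<exists>x0\<in>X0. c x0 = c x"
proof
  have fin: "finite (c ` X)" using assms finite_subset by blast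
  show "inv_into X c ` (c ` X) \<subseteq> X" by (auto intro: inv_into_into)
  show "finite (inv_into X c ` (c ` X))" using fin by simp
  show "card (inv_into X c ` (c ` X)) \<le> card Y"
    using card_image_le[OF fin] card_mono[OF assms] order.trans by blast
  show "\<exists>x0\<in>inv_into X c ` (c ` X). c x0 = c x" if "x \<in> X" for x
    using that by (intro bexI[of _ "inv_into X c (c x)"]) (auto simp: f_inv_into_f)
qed

text \<open>By \<open>mt_cases\<close> a matrix entry that is not always 0 is a kernel entry.
  Nearness to the initial parameters then keeps this entry within \<beta> of its initial value, so
  its cell determines it up to \<open>1 / n\<close>.\<close>

lemma params_near_cell:
  assumes near: "params_near A \<beta> (KN, V) (KN0, V0)" "params_near A \<beta> (KN', V') (KN0, V0)" and n: "n \<ge> 1"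
    and conv: "\<And>l e. (l, e) \<in> conv_index A \<Longrightarrow>
       cell_index \<beta> n (KN l e - KN0 l e) = cell_index \<beta> n (KN' l e - KN0 l e)"
    and full: "\<And>l i j. (l, i, j) \<in> full_index A \<Longrightarrow>
       cell_index \<beta> n (V l i j - V0 l i j) = cell_index \<beta> n (V' l i j - V0 l i j)"
  shows "params_near A (real (num_params A) / real n) (KN, V) (KN', V')"
  unfolding params_near_def fst_conv snd_conv
proof (intro conjI ballI)
  fix l r s assume l: "l \<in> {1..convs A}"
    and rs: "r \<in> grid (side A (l - 1)) (chan A l)" "s \<in> grid (side A (l - 1)) (chan A (l - 1))"
  show "\<bar>conv_mat A l (KN l) r s - conv_mat A l (KN' l) r s\<bar> \<le> real (num_params A) / real n"
    using rs
  proof (cases rule: mt_cases[where p = "ksize A l"])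
    case 1
    thus ?thesis by (simp add: conv_mat_def)
  next
    case (2 e)
    have e: "(l, e) \<in> conv_index A" using 2(1) l by (auto simp: conv_index_def)
    have eq: "conv_mat A l K r s = K e" for K using 2(2) by (simp add: conv_mat_def)
    have "\<bar>KN l e - KN0 l e\<bar> \<le> \<beta>" "\<bar>KN' l e - KN0 l e\<bar> \<le> \<beta>"
      using near l rs unfolding params_near_def by (fastforce simp: eq)+
    from cell_index_eqD[OF conv[OF e] this n] have "\<bar>KN l e - KN' l e\<bar> \<le> 1 / real n" by simp
    \<comment> \<open>An index exists, so there is at least one parameter. The radius carries the
      factor \<open>num_params A\<close> in order to vanish, like the final bound, when there are no
      parameters.\<close>
    also have "1 \<le> num_params A"
      using e card_gt_0_iff[of "conv_index A"] unfolding num_params_eq by fastforce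
    hence "1 / real n \<le> real (num_params A) / real n" by (intro divide_right_mono) auto
    finally show ?thesis by (simp add: eq)
  qed
next
  fix l i j assume l: "l \<in> {1..fulls A}" and ij: "i \<in> {1..width A l}" "j \<in> {1..width A (l - 1)}"
  have e: "(l, i, j) \<in> full_index A" using l ij by (auto simp: full_index_def)
  have "\<bar>V l i j - V0 l i j\<bar> \<le> \<beta>" "\<bar>V' l i j - V0 l i j\<bar> \<le> \<beta>"
    using near l ij unfolding params_near_def by auto
  from cell_index_eqD[OF full[OF e] this n] have "\<bar>V l i j - V' l i j\<bar> \<le> 1 / real n" by simp
  also have "1 \<le> num_params A"
    using e card_gt_0_iff[of "full_index A"] unfolding num_params_eq by fastforce
  hence "1 / real n \<le> real (num_params A) / real n" by (intro divide_right_mono) auto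
  finally show "\<bar>V l i j - V' l i j\<bar> \<le> real (num_params A) / real n" .
qed

text \<open>Parameters in the same cells give nearby networks, so one representative per attained
  combination of cells suffices. \<open>M\<close> is fixed before \<open>n\<close>, which later
  allows \<open>n\<close> to be large in terms of it.\<close>

lemma cnn_class_net:
  assumes A: "is_cnn_arch A d c C" and \<beta>: "0 \<le> \<beta>"
  obtains M where "0 \<le> M" "\<And>n. n \<ge> 1 \<Longrightarrow> \<exists>N \<subseteq> cnn_class A KN0 V0 \<beta>. finite N \<and> N \<noteq> {} \<and>
      card N \<le> (2 * (nat \<lceil>\<beta>\<rceil> * n) + 1) ^ num_params A \<and>
      (\<forall>f\<in>cnn_class A KN0 V0 \<beta>. \<exists>g\<in>N. \<forall>x. L2_set x (grid d c) \<le> R \<longrightarrow>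
         L2_set (\<lambda>j. f x j - g x j) {1..C} \<le> M * real (num_params A) / real n)"
proof -
  let ?W = "num_params A"
  define X where "X = {(KN, V). param_dist A KN V KN0 V0 \<le> \<beta>}"
  define net where "net = (\<lambda>\<theta>. cnn A (fst \<theta>) (snd \<theta>))"
  have F: "cnn_class A KN0 V0 \<beta> = net ` X"
    unfolding cnn_class_def X_def net_def by (force simp: image_iff)
  have near0: "params_near A \<beta> \<theta> (KN0, V0)" if "\<theta> \<in> X" for \<theta>
    using that params_near_param_dist by (auto simp: X_def)
  obtain R' M where M: "0 \<le> M" "\<And>\<theta> \<theta>' \<eta> x x'. \<lbrakk>\<theta> \<in> {\<theta>. params_near A \<beta> \<theta> (KN0, V0)};
        \<theta>' \<in> {\<theta>. params_near A \<beta> \<theta> (KN0, V0)}; 0 \<le> \<eta>; params_near A \<eta> \<theta> \<theta>'; L2_set x (grid d c) \<le> R\<rbrakk> \<Longrightarrow>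
      L2_set (net \<theta> x) {1..C} \<le> R' \<and>
      L2_set (\<lambda>i. net \<theta> x i - net \<theta>' x' i) {1..C} \<le> M * (\<eta> + L2_set (\<lambda>j. x j - x' j) (grid d c))"
    using Lipschitz_family_cnn[OF A, of \<beta> "(KN0, V0)", folded net_def] by (rule Lipschitz_familyE[where R = R]) (rule that)
  show ?thesis
  proof (rule that[OF M(1)])
    fix n :: nat assume n: "n \<ge> 1"
    define m where "m = int (nat \<lceil>\<beta>\<rceil> * n)"
    define Y where "Y = (conv_index A \<rightarrow>\<^sub>E {-m..m}) \<times> (full_index A \<rightarrow>\<^sub>E {-m..m})"
    define cell where "cell = (\<lambda>(KN, V). (\<lambda>(l, e)\<in>conv_index A. cell_index \<beta> n (KN l e - KN0 l e),
       \<lambda>(l, i, j)\<in>full_index A. cell_index \<beta> n (V l i j - V0 l i j)))"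
    have cm: "card {-m..m} = 2 * (nat \<lceil>\<beta>\<rceil> * n) + 1" by (simp add: m_def nat_add_distrib nat_mult_distrib)
    have cardY: "card Y = (2 * (nat \<lceil>\<beta>\<rceil> * n) + 1) ^ ?W"
      unfolding Y_def card_cartesian_product num_params_eq power_add
      by (simp only: card_PiE finite_index prod_constant cm)
    have finY: "finite Y" unfolding Y_def by (intro finite_cartesian_product finite_PiE) auto
    have range: "cell_index \<beta> n t \<in> {-m..m}" for t unfolding m_def by (rule cell_index_range)
    have "cell ` X \<subseteq> Y"
      by (auto simp: cell_def Y_def restrict_PiE_iff range simp del: atLeastAtMost_iff)
    from finite_representatives[OF finY this] obtain X0 where
      X0: "X0 \<subseteq> X" "finite X0" "card X0 \<le> card Y" "\<And>x. x \<in> X \<Longrightarrow> \<exists>x0\<in>X0. cell x0 = cell x"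
      by blast
    have "(KN0, V0) \<in> X" using \<beta> by (simp add: X_def param_dist_refl)
    hence ne: "X0 \<noteq> {}" using X0(4) by blast
    show "\<exists>N \<subseteq> cnn_class A KN0 V0 \<beta>. finite N \<and> N \<noteq> {} \<and>
      card N \<le> (2 * (nat \<lceil>\<beta>\<rceil> * n) + 1) ^ ?W \<and>
      (\<forall>f\<in>cnn_class A KN0 V0 \<beta>. \<exists>g\<in>N. \<forall>x. L2_set x (grid d c) \<le> R \<longrightarrow>
         L2_set (\<lambda>j. f x j - g x j) {1..C} \<le> M * real ?W / real n)"
    proof (intro exI[of _ "net ` X0"] conjI ballI)
      show "net ` X0 \<subseteq> cnn_class A KN0 V0 \<beta>" using X0(1) F by auto
      show "finite (net ` X0)" "net ` X0 \<noteq> {}" using X0(2) ne by auto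
      show "card (net ` X0) \<le> (2 * (nat \<lceil>\<beta>\<rceil> * n) + 1) ^ ?W"
        using card_image_le[OF X0(2), of net] X0(3) cardY by linarith
      fix f assume "f \<in> cnn_class A KN0 V0 \<beta>"
      then obtain \<theta> where \<theta>: "\<theta> \<in> X" "f = net \<theta>" using F by auto
      obtain \<theta>' where \<theta>': "\<theta>' \<in> X0" "cell \<theta>' = cell \<theta>" using X0(4)[OF \<theta>(1)] by blast
      obtain KN V KN' V' where eq: "\<theta> = (KN, V)" "\<theta>' = (KN', V')" by (cases \<theta>, cases \<theta>') auto
      have cc: "(\<lambda>(l, e)\<in>conv_index A. cell_index \<beta> n (KN' l e - KN0 l e)) = (\<lambda>(l, e)\<in>conv_index A. cell_index \<beta> n (KN l e - KN0 l e))"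
        "(\<lambda>(l, i, j)\<in>full_index A. cell_index \<beta> n (V' l i j - V0 l i j)) = (\<lambda>(l, i, j)\<in>full_index A. cell_index \<beta> n (V l i j - V0 l i j))"
        using \<theta>'(2) by (auto simp: cell_def eq)
      have nr: "params_near A \<beta> \<theta> (KN0, V0)" "params_near A \<beta> \<theta>' (KN0, V0)"
        using near0[OF \<theta>(1)] near0[OF subsetD[OF X0(1) \<theta>'(1)]] by auto
      have "params_near A (real ?W / real n) \<theta> \<theta>'"
        unfolding eq
      proof (rule params_near_cell[OF nr[unfolded eq] n])
        fix l e assume "(l, e) \<in> conv_index A"
        thus "cell_index \<beta> n (KN l e - KN0 l e) = cell_index \<beta> n (KN' l e - KN0 l e)"
          using fun_cong[OF cc(1), of "(l, e)"] by simp
      next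
        fix l i j assume "(l, i, j) \<in> full_index A"
        thus "cell_index \<beta> n (V l i j - V0 l i j) = cell_index \<beta> n (V' l i j - V0 l i j)"
          using fun_cong[OF cc(2), of "(l, i, j)"] by simp
      qed
      \<comment> \<open>Both networks are evaluated at the same input, so only the parameter
        distance remains.\<close>
      hence "L2_set (\<lambda>j. f x j - net \<theta>' x j) {1..C} \<le> M * real ?W / real n"
        if "L2_set x (grid d c) \<le> R" for x
        using M(2)[of \<theta> \<theta>' "real ?W / real n" x x] nr that
        by (simp add: \<theta>(2) L2_set_0')
      hence "\<forall>x. L2_set x (grid d c) \<le> R \<longrightarrow>
         L2_set (\<lambda>j. f x j - net \<theta>' x j) {1..C} \<le> M * real ?W / real n" by blast
      thus "\<exists>g\<in>net ` X0. \<forall>x. L2_set x (grid d c) \<le> R \<longrightarrow>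
         L2_set (\<lambda>j. f x j - g x j) {1..C} \<le> M * real ?W / real n"
        using \<theta>'(1) by blast
    qed
  qed
qed

text \<open>Equal parameters are at distance 0, which leaves the dependence on the input. The
  constant may depend on \<open>x\<close>; this still gives continuity and hence
  measurability.\<close>

lemma cnn_class_Lipschitz_at:
  assumes A: "is_cnn_arch A d c C" and f: "f \<in> cnn_class A KN0 V0 \<beta>"
  obtains M where "0 \<le> M" "\<And>x'. L2_set (\<lambda>j. f x j - f x' j) {1..C} \<le> M * L2_set (\<lambda>j. x j - x' j) (grid d c)"
proof -
  obtain KN V where KV: "f = cnn A KN V" "param_dist A KN V KN0 V0 \<le> \<beta>"
    using f by (auto simp: cnn_class_def)
  obtain R' M where M: "0 \<le> M" "\<And>\<theta> \<theta>' \<eta> y y'. \<lbrakk>\<theta> \<in> {\<theta>. params_near A \<beta> \<theta> (KN0, V0)};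
        \<theta>' \<in> {\<theta>. params_near A \<beta> \<theta> (KN0, V0)}; 0 \<le> \<eta>; params_near A \<eta> \<theta> \<theta>'; L2_set y (grid d c) \<le> L2_set x (grid d c)\<rbrakk> \<Longrightarrow>
      L2_set (cnn A (fst \<theta>) (snd \<theta>) y) {1..C} \<le> R' \<and>
      L2_set (\<lambda>i. cnn A (fst \<theta>) (snd \<theta>) y i - cnn A (fst \<theta>') (snd \<theta>') y' i) {1..C} \<le> M * (\<eta> + L2_set (\<lambda>j. y j - y' j) (grid d c))"
    using Lipschitz_family_cnn[OF A, of \<beta> "(KN0, V0)"] by (rule Lipschitz_familyE[where R = "L2_set x (grid d c)"]) (rule that)
  have "params_near A 0 (KN, V) (KN, V)" by (simp add: params_near_def)
  thus ?thesis using M(2)[of "(KN, V)" "(KN, V)" 0 x] params_near_param_dist[OF KV(2)]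
    by (intro that[of M] M(1)) (simp add: KV(1))
qed

section \<open>Measurability and the bound for a fixed sample size\<close>

text \<open>The bound gives continuity in the product topology, whose Borel sets form the product
  \<sigma>-algebra over a countable index type.\<close>

lemma borel_measurable_PiM_Lipschitz_at:
  fixes g :: "('i::countable \<Rightarrow> real) \<Rightarrow> real"
  assumes "\<And>x. \<exists>M. \<forall>x'. \<bar>g x - g x'\<bar> \<le> M * L2_set (\<lambda>i. x i - x' i) I"
  shows "g \<in> borel_measurable (\<Pi>\<^sub>M i\<in>I. borel)"
proof -
  have "isCont g x" for x
  proof -
    obtain M where M: "\<And>x'. \<bar>g x - g x'\<bar> \<le> M * L2_set (\<lambda>i. x i - x' i) I" using assms by blast
    have "continuous_on UNIV (\<lambda>x'. M * L2_set (\<lambda>i. x i - x' i) I)"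
      unfolding L2_set_def by (intro continuous_intros continuous_on_product_coordinates)
    hence "isCont (\<lambda>x'. M * L2_set (\<lambda>i. x i - x' i) I) x"
      by (simp add: continuous_on_eq_continuous_at)
    hence "((\<lambda>x'. M * L2_set (\<lambda>i. x i - x' i) I) \<longlongrightarrow> 0) (at x)"
      by (simp add: isCont_def L2_set_0')
    hence "((\<lambda>x'. g x' - g x) \<longlongrightarrow> 0) (at x)"
      by (rule Lim_null_comparison[rotated]) (use M in \<open>auto simp: abs_minus_commute\<close>)
    thus ?thesis unfolding isCont_def by (simp add: LIM_zero_iff)
  qed
  hence "continuous_on UNIV g" by (simp add: continuous_on_eq_continuous_at)
  hence "g \<in> borel_measurable borel" by (rule borel_measurable_continuous_onI)
  hence g: "g \<in> borel_measurable (\<Pi>\<^sub>M i\<in>UNIV. borel)"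
    by (subst measurable_cong_sets[OF sets_PiM_equal_borel refl])
  \<comment> \<open>Passes from the full product to the one over \<open>I\<close>, where a
    coordinate outside \<open>I\<close> is constantly \<open>undefined\<close>.\<close>
  have "(\<lambda>x. x) \<in> measurable (\<Pi>\<^sub>M i\<in>I. borel) (\<Pi>\<^sub>M i\<in>(UNIV :: 'i set). (borel :: real measure))"
  proof (rule measurable_PiM_single')
    fix i :: 'i
    show "(\<lambda>x. x i) \<in> borel_measurable (\<Pi>\<^sub>M i\<in>I. (borel :: real measure))"
    proof (cases "i \<in> I")
      case False
      have "(\<lambda>x. undefined :: real) \<in> borel_measurable (\<Pi>\<^sub>M i\<in>I. (borel :: real measure))" by simp
      thus ?thesis using False by (subst measurable_cong[where g = "\<lambda>_. undefined"]) (auto simp: space_PiM PiE_def extensional_def)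
    qed simp
  qed auto
  from measurable_compose[OF this g] show ?thesis .
qed

text \<open>The union over \<open>k\<close> of finite nets with precision \<open>1 / (k + 1)\<close>
  on inputs of norm at most \<open>k\<close> serves all radii and precisions at once.\<close>

lemma cnn_class_dense:
  assumes A: "is_cnn_arch A d c C" and \<beta>: "0 \<le> \<beta>"
  obtains F where "F \<subseteq> cnn_class A KN0 V0 \<beta>" "countable F" "F \<noteq> {}"
    "\<And>f R \<epsilon>. f \<in> cnn_class A KN0 V0 \<beta> \<Longrightarrow> 0 < \<epsilon> \<Longrightarrow> \<exists>g\<in>F. \<forall>x. L2_set x (grid d c) \<le> R \<longrightarrow>
         L2_set (\<lambda>j. f x j - g x j) {1..C} \<le> \<epsilon>"
proof -
  let ?F = "cnn_class A KN0 V0 \<beta>"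
  have "\<exists>N \<subseteq> ?F. finite N \<and> N \<noteq> {} \<and> (\<forall>f\<in>?F. \<exists>g\<in>N. \<forall>x. L2_set x (grid d c) \<le> real k \<longrightarrow>
         L2_set (\<lambda>j. f x j - g x j) {1..C} \<le> 1 / real (Suc k))" for k
  proof -
    obtain M where M: "0 \<le> M" "\<And>n. n \<ge> 1 \<Longrightarrow> \<exists>N \<subseteq> ?F. finite N \<and> N \<noteq> {} \<and>
      card N \<le> (2 * (nat \<lceil>\<beta>\<rceil> * n) + 1) ^ num_params A \<and>
      (\<forall>f\<in>?F. \<exists>g\<in>N. \<forall>x. L2_set x (grid d c) \<le> real k \<longrightarrow>
         L2_set (\<lambda>j. f x j - g x j) {1..C} \<le> M * real (num_params A) / real n)"
      using cnn_class_net[OF A \<beta>, where R = "real k"] by blast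
    \<comment> \<open>\<open>M\<close> depends on the radius \<open>k\<close>, so the fineness
      \<open>n\<close> is chosen after it; the successor makes it positive.\<close>
    define n where "n = Suc (nat \<lceil>M * real (num_params A) * real (Suc k)\<rceil>)"
    have "M * real (num_params A) * real (Suc k) \<le> real n" unfolding n_def by linarith
    hence le: "M * real (num_params A) / real n \<le> 1 / real (Suc k)" by (simp add: n_def field_simps)
    obtain N where N: "N \<subseteq> ?F" "finite N" "N \<noteq> {}" "\<forall>f\<in>?F. \<exists>g\<in>N. \<forall>x. L2_set x (grid d c) \<le> real k \<longrightarrow>
         L2_set (\<lambda>j. f x j - g x j) {1..C} \<le> M * real (num_params A) / real n"
      using M(2)[of n] by (auto simp: n_def)
    show ?thesis
    proof (intro exI[of _ N] conjI N(1-3) ballI)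
      fix f assume "f \<in> ?F"
      then obtain g where "g \<in> N" "\<forall>x. L2_set x (grid d c) \<le> real k \<longrightarrow>
         L2_set (\<lambda>j. f x j - g x j) {1..C} \<le> M * real (num_params A) / real n" using N(4) by blast
      thus "\<exists>g\<in>N. \<forall>x. L2_set x (grid d c) \<le> real k \<longrightarrow>
         L2_set (\<lambda>j. f x j - g x j) {1..C} \<le> 1 / real (Suc k)" using le order.trans by blast
    qed
  qed
  hence "\<forall>k. \<exists>N \<subseteq> ?F. finite N \<and> N \<noteq> {} \<and> (\<forall>f\<in>?F. \<exists>g\<in>N. \<forall>x. L2_set x (grid d c) \<le> real k \<longrightarrow>
         L2_set (\<lambda>j. f x j - g x j) {1..C} \<le> 1 / real (Suc k))" by blast
  from choice[OF this] obtain N where N: "\<And>k. N k \<subseteq> ?F" "\<And>k. finite (N k)" "\<And>k. N k \<noteq> {}"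
    "\<And>k f. f \<in> ?F \<Longrightarrow> \<exists>g\<in>N k. \<forall>x. L2_set x (grid d c) \<le> real k \<longrightarrow>
         L2_set (\<lambda>j. f x j - g x j) {1..C} \<le> 1 / real (Suc k)" by blast
  show ?thesis
  proof (rule that[of "\<Union>k. N k"])
    show "(\<Union>k. N k) \<subseteq> ?F" "(\<Union>k. N k) \<noteq> {}" using N(1,3) by auto
    show "countable (\<Union>k. N k)" using N(2) by (auto intro: countable_finite)
    fix f R and \<epsilon> :: real assume f: "f \<in> ?F" and \<epsilon>: "0 < \<epsilon>"
    define k where "k = nat \<lceil>max R (1 / \<epsilon>)\<rceil>"
    have k: "R \<le> real k" "1 / \<epsilon> \<le> real k" unfolding k_def by linarith+
    have "1 / real (Suc k) \<le> \<epsilon>" using k(2) \<epsilon> by (simp add: field_simps)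
    moreover obtain g where "g \<in> N k" "\<forall>x. L2_set x (grid d c) \<le> real k \<longrightarrow>
         L2_set (\<lambda>j. f x j - g x j) {1..C} \<le> 1 / real (Suc k)" using N(4)[OF f, of k] by blast
    ultimately show "\<exists>g\<in>\<Union>k. N k. \<forall>x. L2_set x (grid d c) \<le> R \<longrightarrow>
         L2_set (\<lambda>j. f x j - g x j) {1..C} \<le> \<epsilon>" using k(1) by (meson UN_I UNIV_I order.trans)
  qed
qed

section \<open>Losses of the networks at a fixed sample size\<close>

context
  fixes A :: cnn_arch and d c C KN0 V0 \<beta> D L B0 L1 L2
  fixes F :: "(tensor \<Rightarrow> nat \<Rightarrow> real) set"
  assumes A: "is_cnn_arch A d c C" and \<beta>: "0 \<le> \<beta>"
    and D: "prob_space D" and sets_D: "sets D = sets (sample_space d c C)"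
    and L_bounds: "\<And>s y. y \<in> {1..C} \<Longrightarrow> 0 \<le> L s y \<and> L s y \<le> B0"
    and L12: "0 \<le> L1" "0 \<le> L2"
    and L_Lipschitz: "\<And>s s' y. y \<in> {1..C} \<Longrightarrow>
          \<bar>L s y - L s' y\<bar> \<le> L1 * L2_set (\<lambda>j. s j - s' j) {1..C} + L2 * \<bar>s y - s' y\<bar>"
  defines "F \<equiv> cnn_class A KN0 V0 \<beta>"
begin

lemma space_D: "space D = space (\<Pi>\<^sub>M i\<in>grid d c. (borel :: real measure)) \<times> {1..C}"
  using sets_eq_imp_space_eq[OF sets_D] by (simp add: sample_space_def space_pair_measure)

abbreviation (input) loss :: "(tensor \<Rightarrow> nat \<Rightarrow> real) \<Rightarrow> tensor \<times> nat \<Rightarrow> real" where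
  "loss f \<equiv> \<lambda>(x, y). L (f x) y"

text \<open>A coordinate is at most the Euclidean norm. The joint constant serves for measurability
  and approximation errors; \<open>L1\<close> and \<open>L2\<close> stay apart where the diameter of
  the loss class is bounded.\<close>

lemma L_le:
  assumes "y \<in> {1..C}"
  shows "\<bar>L s y - L s' y\<bar> \<le> (L1 + L2) * L2_set (\<lambda>j. s j - s' j) {1..C}"
proof -
  have "\<bar>s y - s' y\<bar> \<le> L2_set (\<lambda>j. s j - s' j) {1..C}"
    using abs_le_L2_set[OF _ assms, of "\<lambda>j. s j - s' j"] by simp
  hence "L2 * \<bar>s y - s' y\<bar> \<le> L2 * L2_set (\<lambda>j. s j - s' j) {1..C}" using L12 by (intro mult_left_mono)
  thus ?thesis using L_Lipschitz[OF assms, of s s'] by (simp add: algebra_simps)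
qed

lemma loss_le:
  assumes "z \<in> space D" "L2_set (\<lambda>j. f (fst z) j - g (fst z) j) {1..C} \<le> \<epsilon>"
  shows "\<bar>loss f z - loss g z\<bar> \<le> (L1 + L2) * \<epsilon>"
proof -
  have "\<bar>loss f z - loss g z\<bar> \<le> (L1 + L2) * L2_set (\<lambda>j. f (fst z) j - g (fst z) j) {1..C}"
    using assms(1) L_le by (auto simp: space_D)
  also have "\<dots> \<le> (L1 + L2) * \<epsilon>" using assms(2) L12 by (intro mult_left_mono) auto
  finally show ?thesis .
qed

lemma loss_bounds: "z \<in> space D \<Longrightarrow> 0 \<le> loss f z \<and> loss f z \<le> B0"
  using L_bounds by (auto simp: space_D)

text \<open>For each label the loss is measurable in the input by the pointwise Lipschitz bound; the
  finitely many labels are then glued.\<close>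

lemma measurable_loss:
  assumes f: "f \<in> F"
  shows "loss f \<in> borel_measurable D"
proof -
  have "(\<lambda>x. L (f x) y) \<in> borel_measurable (\<Pi>\<^sub>M i\<in>grid d c. borel)" if y: "y \<in> {1..C}" for y
  proof (rule borel_measurable_PiM_Lipschitz_at)
    fix x
    obtain M where M: "0 \<le> M" "\<And>x'. L2_set (\<lambda>j. f x j - f x' j) {1..C} \<le> M * L2_set (\<lambda>j. x j - x' j) (grid d c)"
      using cnn_class_Lipschitz_at[OF A, of f KN0 V0 \<beta> x] f unfolding F_def by blast
    have "\<bar>L (f x) y - L (f x') y\<bar> \<le> (L1 + L2) * M * L2_set (\<lambda>j. x j - x' j) (grid d c)" for x'
    proof -
      have "(L1 + L2) * L2_set (\<lambda>j. f x j - f x' j) {1..C} \<le> (L1 + L2) * (M * L2_set (\<lambda>j. x j - x' j) (grid d c))"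
        using M(2) L12 by (intro mult_left_mono) auto
      thus ?thesis using L_le[OF y, of "f x" "f x'"] by (simp add: mult.assoc)
    qed
    thus "\<exists>M. \<forall>x'. \<bar>L (f x) y - L (f x') y\<bar> \<le> M * L2_set (\<lambda>j. x j - x' j) (grid d c)" by blast
  qed
  hence "(\<lambda>z. L (f (fst z)) (snd z)) \<in> borel_measurable (sample_space d c C)"
    unfolding sample_space_def
    by (intro measurable_compose_countable'[where f = "\<lambda>y z. L (f (fst z)) y" and g = snd and I = "{1..C}"]
        measurable_compose[OF measurable_fst]) auto
  thus ?thesis by (simp add: measurable_cong_sets[OF sets_D refl] split_beta')
qed

lemma integrable_loss:
  assumes "f \<in> F"
  shows "integrable D (loss f)"
proof (rule finite_measure.integrable_const_bound)
  show "finite_measure D" using D by (rule prob_space.finite_measure)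
  show "AE z in D. norm (loss f z) \<le> B0" using loss_bounds by (intro AE_I2) auto
qed (rule measurable_loss[OF assms])

lemma Phi_eq:
  "Phi D L F B0 n S \<delta> = (SUP f\<in>F. (\<integral>z. loss f z \<partial>D) - (1 / real n) * (\<Sum>i=1..n. loss f (S i)))
     - 3 * B0 * sqrt (ln (2 / \<delta>) / (2 * real n))"
  by (simp add: Phi_def risk_def emp_risk_def)

text \<open>Makes the event that \<open>Phi\<close> is at most \<open>b\<close> measurable, so that
  its probability is at least that of a measurable event inside it.\<close>

lemma measurable_Phi:
  assumes n: "n \<ge> 1" and bounded: "AE (x, y) in D. L2_set x (grid d c) \<le> chi"
  shows "(\<lambda>S. Phi D L F B0 n S \<delta>) \<in> borel_measurable (\<Pi>\<^sub>M i\<in>{1..n}. D)"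
proof -
  let ?P = "\<Pi>\<^sub>M i\<in>{1..n}. D"
  interpret D: prob_space D by (rule D)
  define dev where "dev f S = (\<integral>z. loss f z \<partial>D) - (1 / real n) * (\<Sum>i=1..n. loss f (S i))" for f S
  obtain F' where F': "F' \<subseteq> F" "countable F'" "F' \<noteq> {}"
    "\<And>f R \<epsilon>. f \<in> F \<Longrightarrow> 0 < \<epsilon> \<Longrightarrow> \<exists>g\<in>F'. \<forall>x. L2_set x (grid d c) \<le> R \<longrightarrow>
         L2_set (\<lambda>j. f x j - g x j) {1..C} \<le> \<epsilon>"
    using cnn_class_dense[OF A \<beta>] unfolding F_def by blast
  have S_D: "S i \<in> space D" if "S \<in> space ?P" "i \<in> {1..n}" for S i
    using that by (auto simp: space_PiM)
  have bdd: "bdd_above ((\<lambda>f. dev f S) ` F)" if S: "S \<in> space ?P" for S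
  proof (rule bdd_aboveI2)
    fix f assume f: "f \<in> F"
    have "(\<integral>z. loss f z \<partial>D) \<le> B0"
      using loss_bounds by (intro D.integral_le_const integrable_loss f AE_I2) auto
    moreover have "0 \<le> (1 / real n) * (\<Sum>i=1..n. loss f (S i))"
      using loss_bounds[OF S_D[OF S]] by (intro mult_nonneg_nonneg sum_nonneg) auto
    ultimately show "dev f S \<le> B0" unfolding dev_def by linarith
  qed
  \<comment> \<open>The supremum over the uncountable class is measurable since a countable dense subset has the same one.\<close>
  have eq: "(SUP f\<in>F. dev f S) = (SUP f\<in>F'. dev f S)" if S: "S \<in> space ?P" for S
  proof (rule antisym)
    show "(SUP f\<in>F'. dev f S) \<le> (SUP f\<in>F. dev f S)"
      using F' bdd[OF S] by (intro cSUP_subset_mono) auto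
    have bdd': "bdd_above ((\<lambda>f. dev f S) ` F')" using bdd[OF S] F'(1) by (meson bdd_above_mono image_mono)
    show "(SUP f\<in>F. dev f S) \<le> (SUP f\<in>F'. dev f S)"
    proof (rule cSUP_least)
      show "F \<noteq> {}" using F' by auto
      fix f assume f: "f \<in> F"
      \<comment> \<open>The summand 1 keeps \<open>K\<close> positive when both Lipschitz constants
        are 0.\<close>
      define K where "K = L1 + L2 + 1"
      have K: "0 < K" using L12 by (simp add: K_def)
      show "dev f S \<le> (SUP f\<in>F'. dev f S)"
      proof (rule field_le_epsilon)
        fix e :: real assume e: "0 < e"
        \<comment> \<open>The radius covers almost every input as well as the given sample, whose
          points may have norm above \<open>chi\<close>.\<close>
        define R where "R = max chi (\<Sum>i=1..n. L2_set (fst (S i)) (grid d c))"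
        obtain g where g: "g \<in> F'" "\<And>x. L2_set x (grid d c) \<le> R \<Longrightarrow>
            L2_set (\<lambda>j. f x j - g x j) {1..C} \<le> e / (2 * K)"
          using F'(4)[OF f, of "e / (2 * K)" R] e K by auto
        have "dev f S \<le> dev g S + 2 * ((L1 + L2) * (e / (2 * K)))"
          unfolding dev_def
        proof (rule deviation_le[OF D integrable_loss integrable_loss n])
          show "g \<in> F" "f \<in> F" using f g F' by auto
          show "AE z in D. \<bar>loss f z - loss g z\<bar> \<le> (L1 + L2) * (e / (2 * K))"
            using bounded AE_space
          proof eventually_elim
            case (elim z)
            hence "L2_set (fst z) (grid d c) \<le> R" by (auto simp: R_def)
            from loss_le[of z f g, OF elim(2) g(2)[OF this]] show ?case .
          qed
          fix i assume i: "i \<in> {1..n}"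
          have "L2_set (fst (S i)) (grid d c) \<le> (\<Sum>i=1..n. L2_set (fst (S i)) (grid d c))"
            using i by (intro member_le_sum) auto
          hence "L2_set (fst (S i)) (grid d c) \<le> R" by (simp add: R_def)
          from loss_le[of "S i" f g, OF S_D[OF S i] g(2)[OF this]]
          show "\<bar>loss f (S i) - loss g (S i)\<bar> \<le> (L1 + L2) * (e / (2 * K))" .
        qed
        also have "2 * ((L1 + L2) * (e / (2 * K))) \<le> e"
          using e K by (simp add: field_simps K_def)
        also have "dev g S \<le> (SUP f\<in>F'. dev f S)" using g(1) bdd' by (rule cSUP_upper)
        finally show "dev f S \<le> (SUP f\<in>F'. dev f S) + e" by simp
      qed
    qed
  qed
  have dev_meas: "dev f \<in> borel_measurable ?P" if f: "f \<in> F'" for f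
  proof -
    note [measurable] = measurable_loss[OF subsetD[OF F'(1) f]]
    show ?thesis unfolding dev_def by measurable
  qed
  have "(\<lambda>S. SUP f\<in>F'. dev f S) \<in> borel_measurable ?P"
  proof (rule borel_measurable_cSUP[OF F'(2) dev_meas])
    fix S assume "S \<in> space ?P"
    thus "bdd_above ((\<lambda>f. dev f S) ` F')" using bdd F'(1) by (meson bdd_above_mono image_mono)
  qed
  hence "(\<lambda>S. SUP f\<in>F. dev f S) \<in> borel_measurable ?P"
    using measurable_cong[of ?P "\<lambda>S. SUP f\<in>F. dev f S" "\<lambda>S. SUP f\<in>F'. dev f S" borel] eq by blast
  thus ?thesis unfolding Phi_eq dev_def by (intro borel_measurable_diff) auto
qed

text \<open>\<open>uniform_deviation\<close> is applied to the loss class; its confidence term is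
  exactly the one that \<open>Phi\<close> subtracts.\<close>

lemma Phi_bound:
  assumes n: "n \<ge> 1" and \<delta>: "0 < \<delta>" "\<delta> < 1"
    and bounded: "AE (x, y) in D. L2_set x (grid d c) \<le> chi"
    and scores: "AE (x, y) in D. \<forall>f\<in>F. \<forall>g\<in>F. \<forall>j\<in>{1..C}. \<bar>f x j - g x j\<bar> \<le> 1"
    and N: "N \<subseteq> F" "finite N" "N \<noteq> {}"
    and net: "\<And>f. f \<in> F \<Longrightarrow> \<exists>g\<in>N. \<forall>x. L2_set x (grid d c) \<le> chi \<longrightarrow>
               L2_set (\<lambda>j. f x j - g x j) {1..C} \<le> \<epsilon>"
    and b: "2 * (L1 * sqrt (real C) + L2) * sqrt (ln (real (card N)) / (2 * real n)) + 2 * ((L1 + L2) * \<epsilon>) \<le> b"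
  shows "measure (\<Pi>\<^sub>M i\<in>{1..n}. D) {S \<in> space (\<Pi>\<^sub>M i\<in>{1..n}. D). Phi D L F B0 n S \<delta> \<le> b} \<ge> 1 - \<delta>"
proof -
  let ?P = "\<Pi>\<^sub>M i\<in>{1..n}. D" and ?\<Delta> = "L1 * sqrt (real C) + L2"
  interpret P: prob_space ?P by (intro prob_space_PiM D)
  define G where "G = {z \<in> space D. L2_set (fst z) (grid d c) \<le> chi}"
  have \<Delta>: "0 \<le> ?\<Delta>" using L12 by simp
  have scores': "AE z in D. \<forall>u\<in>loss ` F. \<forall>v\<in>loss ` F. \<bar>u z - v z\<bar> \<le> ?\<Delta>"
    using scores AE_space
  proof eventually_elim
    case (elim z)
    obtain x y where z: "z = (x, y)" by (cases z)
    have y: "y \<in> {1..C}" using elim(2) z by (simp add: space_D)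
    have "\<bar>loss f z - loss g z\<bar> \<le> ?\<Delta>" if fg: "f \<in> F" "g \<in> F" for f g
    proof -
      have le: "\<bar>f x j - g x j\<bar> \<le> 1" if "j \<in> {1..C}" for j using elim(1) fg that by (auto simp: z)
      \<comment> \<open>The factor \<open>sqrt C\<close> arises here: it is the Euclidean length of
        a vector with \<open>C\<close> entries of size at most 1.\<close>
      have "(\<Sum>j=1..C. (f x j - g x j)\<^sup>2) \<le> (\<Sum>j=1..C. 1)"
        using le by (intro sum_mono) (auto simp: abs_square_le_1)
      hence "L2_set (\<lambda>j. f x j - g x j) {1..C} \<le> sqrt (real C)"
        unfolding L2_set_def by (intro real_sqrt_le_mono) simp
      hence "L1 * L2_set (\<lambda>j. f x j - g x j) {1..C} + L2 * \<bar>f x y - g x y\<bar> \<le> L1 * sqrt (real C) + L2 * 1"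
        using L12 le[OF y] by (intro add_mono mult_left_mono) auto
      thus ?thesis using L_Lipschitz[OF y, of "f x" "g x"] by (simp add: z)
    qed
    thus ?case by blast
  qed
  have "AE z in D. z \<in> G" unfolding G_def using bounded AE_space by eventually_elim auto
  from D _ _ \<Delta> scores' _ _ _ _ this n \<delta> obtain E where E: "E \<in> sets ?P" "measure ?P E \<le> \<delta>"
    "\<And>S h. S \<in> space ?P - E \<Longrightarrow> h \<in> loss ` F \<Longrightarrow>
       (\<integral>z. h z \<partial>D) - (1 / real n) * (\<Sum>i=1..n. h (S i))
         \<le> 3 * B0 * sqrt (ln (2 / \<delta>) / (2 * real n))
            + 2 * ?\<Delta> * sqrt (ln (real (card (loss ` N))) / (2 * real n)) + 2 * ((L1 + L2) * \<epsilon>)"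
  proof (rule uniform_deviation[where N = "loss ` N" and \<epsilon> = "(L1 + L2) * \<epsilon>"])
    show "h \<in> borel_measurable D" if "h \<in> loss ` F" for h using that measurable_loss by auto
    show "0 \<le> h z \<and> h z \<le> B0" if "h \<in> loss ` F" "z \<in> space D" for h z
      using loss_bounds[OF that(2)] that(1) by blast
    show "loss ` N \<subseteq> loss ` F" "finite (loss ` N)" "loss ` N \<noteq> {}" using N by auto
    fix h assume "h \<in> loss ` F"
    then obtain f where f: "f \<in> F" "h = loss f" by auto
    obtain g where g: "g \<in> N" "\<And>x. L2_set x (grid d c) \<le> chi \<Longrightarrow>
        L2_set (\<lambda>j. f x j - g x j) {1..C} \<le> \<epsilon>" using net[OF f(1)] by blast
    show "\<exists>g\<in>loss ` N. \<forall>z\<in>G. \<bar>h z - g z\<bar> \<le> (L1 + L2) * \<epsilon>"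
    proof (intro bexI[of _ "loss g"] ballI)
      fix z assume "z \<in> G"
      hence z: "z \<in> space D" "L2_set (fst z) (grid d c) \<le> chi" by (auto simp: G_def)
      from loss_le[of z f g, OF z(1) g(2)[OF z(2)]] show "\<bar>h z - loss g z\<bar> \<le> (L1 + L2) * \<epsilon>" by (simp add: f(2))
    qed (use g in auto)
  qed (rule that)
  let ?A = "{S \<in> space ?P. Phi D L F B0 n S \<delta> \<le> b}"
  have "space ?P - E \<subseteq> ?A"
  proof
    fix S assume S: "S \<in> space ?P - E"
    \<comment> \<open>Different networks can have equal losses, so the net of losses may be smaller
      than \<open>N\<close>; monotonicity of the logarithm uses that it is nonempty.\<close>
    have card: "1 \<le> real (card (loss ` N))" "real (card (loss ` N)) \<le> real (card N)"
      using N card_image_le[OF N(2)] by (auto simp: Suc_le_eq card_gt_0_iff)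
    have "sqrt (ln (real (card (loss ` N))) / (2 * real n)) \<le> sqrt (ln (real (card N)) / (2 * real n))"
      using card by (intro real_sqrt_le_mono divide_right_mono) auto
    hence "2 * ?\<Delta> * sqrt (ln (real (card (loss ` N))) / (2 * real n)) \<le> 2 * ?\<Delta> * sqrt (ln (real (card N)) / (2 * real n))"
      using \<Delta> by (intro mult_left_mono) auto
    hence le: "(\<integral>z. loss f z \<partial>D) - (1 / real n) * (\<Sum>i=1..n. loss f (S i))
        \<le> 3 * B0 * sqrt (ln (2 / \<delta>) / (2 * real n)) + b" if "f \<in> F" for f
      using E(3)[OF S imageI[OF that]] b by linarith
    have "(SUP f\<in>F. (\<integral>z. loss f z \<partial>D) - (1 / real n) * (\<Sum>i=1..n. loss f (S i)))
        \<le> 3 * B0 * sqrt (ln (2 / \<delta>) / (2 * real n)) + b"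
      using N by (intro cSUP_least le) auto
    thus "S \<in> ?A" using S unfolding Phi_eq by simp
  qed
  moreover have "?A \<in> sets ?P" using measurable_Phi[OF n bounded] by measurable
  ultimately have "measure ?P (space ?P - E) \<le> measure ?P ?A" by (intro P.finite_measure_mono)
  moreover have "measure ?P (space ?P - E) = 1 - measure ?P E" using E(1) by (rule P.prob_compl)
  ultimately show ?thesis using E(2) by linarith
qed

end

section \<open>Large sample sizes\<close>

text \<open>\<open>1 + \<nu>\<close> bounds the spectral norm of some layer, so it is nonnegative
  even for negative \<nu>. Without layers the power is 1.\<close>

lemma B_const_pos:
  assumes "init_bounded A KN0 V0 \<nu>" "0 < \<beta>" "0 < chi"
  shows "0 < B_const A \<beta> \<nu> chi"
proof (cases "convs A + fulls A = 0")
  case False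
  have "0 \<le> 1 + \<nu>"
  proof (cases "convs A = 0")
    case True
    hence "full_norm A 1 (V0 1) \<le> 1 + \<nu>" using assms(1) False by (simp add: init_bounded_def)
    moreover have "0 \<le> full_norm A 1 (V0 1)" unfolding full_norm_def by (intro spectral_norm_nonneg) auto
    ultimately show ?thesis by linarith
  next
    case False
    hence "conv_norm A 1 (conv_mat A 1 (KN0 1)) \<le> 1 + \<nu>" using assms(1) by (simp add: init_bounded_def)
    moreover have "0 \<le> conv_norm A 1 (conv_mat A 1 (KN0 1))" unfolding conv_norm_def by (intro spectral_norm_nonneg) auto
    ultimately show ?thesis by linarith
  qed
  moreover have "0 < \<beta> / real (convs A + fulls A)" using False assms(2) by (intro divide_pos_pos) auto
  ultimately have "0 < 1 + \<nu> + \<beta> / real (convs A + fulls A)" by linarith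
  thus ?thesis using assms by (simp add: B_const_def)
qed (use assms in \<open>simp add: B_const_def\<close>)

text \<open>The lower bound on \<open>x\<close> says that \<open>sqrt x * B\<close> is at least 1,
  that is, \<open>x * B \<ge> sqrt x\<close>. This brings \<open>B_const\<close> into the logarithm
  even if it is less than 1.\<close>

lemma half_ln_le_ln_mult:
  fixes x B :: real
  assumes "1 \<le> x" "0 < B" "1 / B\<^sup>2 \<le> x"
  shows "ln x / 2 \<le> ln (x * B)"
proof -
  have "sqrt (1 / B\<^sup>2) \<le> sqrt x" using assms by (intro real_sqrt_le_mono)
  hence "1 \<le> sqrt x * B" using assms by (simp add: real_sqrt_divide field_simps)
  hence "sqrt x * 1 \<le> sqrt x * (sqrt x * B)" using assms by (intro mult_left_mono) auto
  also have "\<dots> = x * B" using assms by (simp add: mult.assoc[symmetric])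
  finally have "ln (sqrt x) \<le> ln (x * B)" using assms by (intro ln_mono) auto
  thus ?thesis using assms by (simp add: ln_sqrt)
qed

text \<open>The logarithm of \<open>k\<close> is at most \<open>2 * W * ln n\<close>, and the square
  root of \<open>W * ln n\<close> is at most \<open>W * ln n\<close> since this number is 0 or at
  least 1.\<close>

lemma sqrt_ln_card_le:
  assumes n: "1 \<le> ln (real n)" and k: "0 < k" "k \<le> (n\<^sup>2) ^ W"
  shows "sqrt (ln (real k) / (2 * real n)) \<le> real W * ln (real n) / sqrt (real n)"
proof -
  have n0: "0 < real n" using n by (cases "n = 0") auto
  have "ln (real k) \<le> ln (real ((n\<^sup>2) ^ W))" 
    using k of_nat_le_iff[of k "(n\<^sup>2) ^ W", where 'a = real] by (intro ln_mono) auto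
  also have "\<dots> = 2 * (real W * ln (real n))" using n0 by (simp add: ln_realpow)
  finally have "ln (real k) / (2 * real n) \<le> (real W * ln (real n)) / real n"
    using n0 by (simp add: field_simps)
  hence "sqrt (ln (real k) / (2 * real n)) \<le> sqrt (real W * ln (real n)) / sqrt (real n)"
    unfolding real_sqrt_divide[symmetric] by (rule real_sqrt_le_mono)
  also have "sqrt (real W * ln (real n)) \<le> real W * ln (real n)"
  proof (cases "W = 0")
    case False
    hence "1 * 1 \<le> real W * ln (real n)" using n by (intro mult_mono) auto
    hence "real W * ln (real n) * 1 \<le> real W * ln (real n) * (real W * ln (real n))" by (intro mult_left_mono) auto
    thus ?thesis using n by (intro real_le_lsqrt) (auto simp: power2_eq_square)
  qed simp
  finally show ?thesis using n0 by (simp add: divide_right_mono)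
qed

text \<open>Turns the bound on the absolute value into the range from 0 to \<open>B0\<close>; a
  range of twice that length would double the confidence term.\<close>

lemma topk_loss_nonneg:
  assumes "\<And>t. 0 \<le> ell t"
  shows "0 \<le> topk_loss ell K C s y"
  unfolding topk_loss_def using assms by (intro mult_nonneg_nonneg sum_nonneg) auto

section \<open>Choice of the absolute constants and of the threshold for the sample size\<close>

theorem theorem7:
  shows "\<exists>c1>0. \<exists>c2>0.
    \<forall>(A :: cnn_arch) d c C KN0 V0 \<beta> \<nu> chi.
      is_cnn_arch A d c C \<and> init_bounded A KN0 V0 \<nu> \<and> 0 < \<beta> \<and> 0 < chi \<longrightarrow>
      (\<forall>\<^sub>F n in sequentially.
        \<forall>D ell K B0 L1 L2 \<delta>.
          prob_space D \<and> sets D = sets (sample_space d c C) \<and>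
          (AE (x, y) in D. L2_set (tvec d c x) {1..d * d * c} \<le> chi) \<and>
          (AE (x, y) in D. \<forall>f\<in>cnn_class A KN0 V0 \<beta>. \<forall>g\<in>cnn_class A KN0 V0 \<beta>.
             \<forall>j\<in>{1..C}. \<bar>f x j - g x j\<bar> \<le> 1) \<and>
          (\<forall>t. 0 \<le> ell t) \<and> 1 \<le> K \<and> K \<le> C - 1 \<and>
          0 < B0 \<and> (\<forall>s. \<forall>y\<in>{1..C}. \<bar>topk_loss ell K C s y\<bar> \<le> B0) \<and>
          0 \<le> L1 \<and> 0 \<le> L2 \<and>
          (\<forall>s s'. \<forall>y\<in>{1..C}. \<bar>topk_loss ell K C s y - topk_loss ell K C s' y\<bar>
             \<le> L1 * L2_set (\<lambda>j. s j - s' j) {1..C} + L2 * \<bar>s y - s' y\<bar>) \<and>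
          0 < \<delta> \<and> \<delta> < 1 \<longrightarrow>
          measure (\<Pi>\<^sub>M i\<in>{1..n}. D)
            {S \<in> space (\<Pi>\<^sub>M i\<in>{1..n}. D).
               Phi D (topk_loss ell K C) (cnn_class A KN0 V0 \<beta>) B0 n S \<delta>
                 \<le> c1 * (real (num_params A) * L1 * sqrt (real C)
                          * ln (real n * real C * B_const A \<beta> \<nu> chi) / sqrt (real n))
                 + c2 * (real (num_params A) * L2
                          * ln (real n * B_const A \<beta> \<nu> chi) / sqrt (real n))}
            \<ge> 1 - \<delta>)"
proof (intro exI[of _ "8 :: real"] conjI allI impI)
  fix A :: cnn_arch and d c C KN0 V0 and \<beta> \<nu> chi :: real
  assume asm: "is_cnn_arch A d c C \<and> init_bounded A KN0 V0 \<nu> \<and> 0 < \<beta> \<and> 0 < chi"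
  hence A: "is_cnn_arch A d c C" and \<beta>: "0 \<le> \<beta>" by auto
  let ?W = "num_params A" and ?B = "B_const A \<beta> \<nu> chi" and ?F = "cnn_class A KN0 V0 \<beta>"
  have B: "0 < ?B" using asm B_const_pos by blast
  define m where "m = nat \<lceil>\<beta>\<rceil>"
  obtain M where M: "0 \<le> M" "\<And>n. n \<ge> 1 \<Longrightarrow> \<exists>N \<subseteq> ?F. finite N \<and> N \<noteq> {} \<and>
      card N \<le> (2 * (m * n) + 1) ^ ?W \<and>
      (\<forall>f\<in>?F. \<exists>g\<in>N. \<forall>x. L2_set x (grid d c) \<le> chi \<longrightarrow>
         L2_set (\<lambda>j. f x j - g x j) {1..C} \<le> M * real ?W / real n)"
    using cnn_class_net[OF A \<beta>, where R = chi] unfolding m_def by blast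
  \<comment> \<open>The summands provide, in turn, \<open>ln n \<ge> 1\<close>, at most
    \<open>n * n\<close> cells per parameter, \<open>M \<le> sqrt n\<close>, and the condition of
    \<open>half_ln_le_ln_mult\<close>. None of them depends on the distribution, the loss or
    \<delta>.\<close>
  define n0 where "n0 = 3 + 2 * real m + M\<^sup>2 + 1 / ?B\<^sup>2"
  have "\<forall>\<^sub>F n in sequentially. n0 \<le> real n"
    using filterlim_real_sequentially by (simp add: filterlim_at_top)
  thus "\<forall>\<^sub>F n in sequentially. \<forall>D ell K B0 L1 L2 \<delta>.
          prob_space D \<and> sets D = sets (sample_space d c C) \<and>
          (AE (x, y) in D. L2_set (tvec d c x) {1..d * d * c} \<le> chi) \<and>
          (AE (x, y) in D. \<forall>f\<in>?F. \<forall>g\<in>?F. \<forall>j\<in>{1..C}. \<bar>f x j - g x j\<bar> \<le> 1) \<and>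
          (\<forall>t. 0 \<le> ell t) \<and> 1 \<le> K \<and> K \<le> C - 1 \<and>
          0 < B0 \<and> (\<forall>s. \<forall>y\<in>{1..C}. \<bar>topk_loss ell K C s y\<bar> \<le> B0) \<and>
          0 \<le> L1 \<and> 0 \<le> L2 \<and>
          (\<forall>s s'. \<forall>y\<in>{1..C}. \<bar>topk_loss ell K C s y - topk_loss ell K C s' y\<bar>
             \<le> L1 * L2_set (\<lambda>j. s j - s' j) {1..C} + L2 * \<bar>s y - s' y\<bar>) \<and>
          0 < \<delta> \<and> \<delta> < 1 \<longrightarrow>
          measure (\<Pi>\<^sub>M i\<in>{1..n}. D)
            {S \<in> space (\<Pi>\<^sub>M i\<in>{1..n}. D).
               Phi D (topk_loss ell K C) ?F B0 n S \<delta>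
                 \<le> 8 * (real ?W * L1 * sqrt (real C) * ln (real n * real C * ?B) / sqrt (real n))
                 + 8 * (real ?W * L2 * ln (real n * ?B) / sqrt (real n))}
            \<ge> 1 - \<delta>"
  proof (eventually_elim, intro allI impI, elim conjE)
    fix n D ell K B0 L1 L2 and \<delta> :: real
    assume n0: "n0 \<le> real n"
      and D: "prob_space D" "sets D = sets (sample_space d c C)"
      and bounded: "AE (x, y) in D. L2_set (tvec d c x) {1..d * d * c} \<le> chi"
      and scores: "AE (x, y) in D. \<forall>f\<in>?F. \<forall>g\<in>?F. \<forall>j\<in>{1..C}. \<bar>f x j - g x j\<bar> \<le> 1"
      and ell: "\<forall>t. 0 \<le> ell t" and K: "1 \<le> K" "K \<le> C - 1"
      and B0: "0 < B0" "\<forall>s. \<forall>y\<in>{1..C}. \<bar>topk_loss ell K C s y\<bar> \<le> B0"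
      and L12: "0 \<le> L1" "0 \<le> L2"
      and Lip: "\<forall>s s'. \<forall>y\<in>{1..C}. \<bar>topk_loss ell K C s y - topk_loss ell K C s' y\<bar>
             \<le> L1 * L2_set (\<lambda>j. s j - s' j) {1..C} + L2 * \<bar>s y - s' y\<bar>"
      and \<delta>: "0 < \<delta>" "\<delta> < 1"
    have C: "1 \<le> real C" using K by simp
    have inv: "0 \<le> 1 / ?B\<^sup>2" by simp
    have nn: "3 \<le> real n" "1 + 2 * real m \<le> real n" "M\<^sup>2 \<le> real n" "1 / ?B\<^sup>2 \<le> real n"
      using n0 inv zero_le_power2[of M] unfolding n0_def by linarith+
    have n1: "n \<ge> 1" using nn(1) by simp
    have "exp 1 \<le> real n" using exp_le nn(1) by linarith
    hence ln: "1 \<le> ln (real n)" using n1 by (simp add: ln_ge_iff)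
    have sn: "0 < sqrt (real n)" using n1 by simp
    obtain N where N: "N \<subseteq> ?F" "finite N" "N \<noteq> {}" "card N \<le> (2 * (m * n) + 1) ^ ?W"
      "\<And>f. f \<in> ?F \<Longrightarrow> \<exists>g\<in>N. \<forall>x. L2_set x (grid d c) \<le> chi \<longrightarrow>
         L2_set (\<lambda>j. f x j - g x j) {1..C} \<le> M * real ?W / real n"
      using M(2)[OF n1] by blast
    have "2 * (m * n) + 1 \<le> (1 + 2 * m) * n" using n1 by (simp add: algebra_simps)
    also have "\<dots> \<le> n * n" using nn(2) by (intro mult_right_mono) linarith+
    finally have "card N \<le> (n\<^sup>2) ^ ?W"
      using N(4) power_mono[of "2 * (m * n) + 1" "n\<^sup>2" ?W] by (simp add: power2_eq_square)
    hence card: "sqrt (ln (real (card N)) / (2 * real n)) \<le> real ?W * ln (real n) / sqrt (real n)"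
      using N(2,3) by (intro sqrt_ln_card_le ln) (auto simp: card_gt_0_iff)
    \<comment> \<open>The Lipschitz constant is absorbed here: half a power of \<open>n\<close> pays
      for it.\<close>
    have "M \<le> sqrt (real n)" using nn(3) by (rule real_le_rsqrt)
    hence "M * real ?W / real n \<le> sqrt (real n) * real ?W / real n"
      by (intro divide_right_mono mult_right_mono) auto
    also have "\<dots> = real ?W / sqrt (real n)" using n1 by (simp add: field_simps)
    also have "\<dots> \<le> real ?W * ln (real n) / sqrt (real n)"
      using ln sn mult_left_mono[OF ln, of "real ?W"] by (intro divide_right_mono) auto
    finally have eps: "M * real ?W / real n \<le> real ?W * ln (real n) / sqrt (real n)" .
    define t where "t = real ?W * ln (real n) / sqrt (real n)"
    have t0: "0 \<le> t" unfolding t_def using ln by simp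
    \<comment> \<open>Lets the approximation error, with its constant \<open>L1 + L2\<close>, be
      merged into the term with the diameter.\<close>
    have sC: "L1 \<le> L1 * sqrt (real C)" using mult_left_mono[of 1 "sqrt (real C)" L1] C L12 by simp
    have half: "ln (real n) / 2 \<le> ln (real n * ?B)"
      using nn B by (intro half_ln_le_ln_mult) auto
    also have "real n * ?B * 1 \<le> real n * ?B * real C" using C B by (intro mult_left_mono) auto
    hence "ln (real n * ?B) \<le> ln (real n * real C * ?B)"
      using n1 B C by (intro ln_mono) (auto simp: mult_ac)
    finally have half': "ln (real n) / 2 \<le> ln (real n * real C * ?B)" .
    \<comment> \<open>Origin of the constant 8: net size and approximation error contribute 2 each,
      and passing from \<open>ln n\<close> to \<open>u\<close> doubles their sum.\<close>
    have scale: "4 * (x * t) \<le> 8 * (real ?W * x * u / sqrt (real n))"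
      if "ln (real n) / 2 \<le> u" "0 \<le> x" for x u
    proof -
      have "real ?W * x * (ln (real n) / 2) / sqrt (real n) \<le> real ?W * x * u / sqrt (real n)"
        using that by (intro divide_right_mono mult_left_mono) auto
      moreover have "4 * (x * t) = 8 * (real ?W * x * (ln (real n) / 2) / sqrt (real n))" by (simp add: t_def)
      ultimately show ?thesis by linarith
    qed
    have "2 * (L1 * sqrt (real C) + L2) * sqrt (ln (real (card N)) / (2 * real n)) \<le> 2 * (L1 * sqrt (real C) + L2) * t"
      using card L12 unfolding t_def by (intro mult_left_mono) auto
    moreover have "(L1 + L2) * (M * real ?W / real n) \<le> (L1 * sqrt (real C) + L2) * t"
      using eps sC L12 t0 M(1) unfolding t_def[symmetric] by (intro mult_mono) auto
    moreover have "2 * (L1 * sqrt (real C) + L2) * t + 2 * ((L1 * sqrt (real C) + L2) * t)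
        = 4 * (L1 * sqrt (real C) * t) + 4 * (L2 * t)"
      by (simp add: algebra_simps)
    ultimately have "2 * (L1 * sqrt (real C) + L2) * sqrt (ln (real (card N)) / (2 * real n))
        + 2 * ((L1 + L2) * (M * real ?W / real n)) \<le> 4 * (L1 * sqrt (real C) * t) + 4 * (L2 * t)"
      by linarith
    also have "\<dots> \<le> 8 * (real ?W * (L1 * sqrt (real C)) * ln (real n * real C * ?B) / sqrt (real n))
                 + 8 * (real ?W * L2 * ln (real n * ?B) / sqrt (real n))"
      using half half' L12 by (intro add_mono scale) auto
    finally have b: "2 * (L1 * sqrt (real C) + L2) * sqrt (ln (real (card N)) / (2 * real n))
        + 2 * ((L1 + L2) * (M * real ?W / real n))
        \<le> 8 * (real ?W * L1 * sqrt (real C) * ln (real n * real C * ?B) / sqrt (real n))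
          + 8 * (real ?W * L2 * ln (real n * ?B) / sqrt (real n))"
      by (simp only: mult.assoc)
    have bounds: "0 \<le> topk_loss ell K C s y \<and> topk_loss ell K C s y \<le> B0" if "y \<in> {1..C}" for s y
      using topk_loss_nonneg[of ell K C s y] ell B0(2) that by (meson abs_le_D1)
    show "1 - \<delta> \<le> measure (\<Pi>\<^sub>M i\<in>{1..n}. D)
            {S \<in> space (\<Pi>\<^sub>M i\<in>{1..n}. D).
               Phi D (topk_loss ell K C) ?F B0 n S \<delta>
                 \<le> 8 * (real ?W * L1 * sqrt (real C) * ln (real n * real C * ?B) / sqrt (real n))
                 + 8 * (real ?W * L2 * ln (real n * ?B) / sqrt (real n))}"
      using Lip by (intro Phi_bound[OF A \<beta> D bounds L12 _ n1 \<delta> bounded[unfolded L2_set_tvec] scores N(1-3) N(5) b]) auto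
  qed
qed simp_all

end
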